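(* Let $\hbar>0$, $N\ge1$, and let $\Sigma=SDS^{\mathsf T}$, $D=\bigoplus_{k=1}^N\nu_k\mathbb 1_2$, $S\in\operatorname{Sp}(2N,\mathbb R)$, be the Williamson decomposition of an admissible covariance matrix, with $x_k=2\nu_k/\hbar\ge1$. Relative to the trace pairing, the dual Bures quadratic form is represented by the operator on $\operatorname{Sym}(2N)$ $$\mathcal G_{{\rm B},\Sigma}(P)=8\Sigma P\Sigma+2\hbar^2\Omega P\Omega.$$ (I) At the Williamson representative $D$, $\operatorname{Sym}(2N)$ decomposes into the following invariant sectors, on each of which $\mathcal G_{{\rm B},D}$ acts as multiplication by the indicated weight: 1. Local scalar sectors: for each mode $k$, the scalar diagonal block, with weight $\lambda_{{\rm rad},k}=2\hbar^2(x_k^2-1)$; total multiplicity $N$. 2. Local traceless sectors: for each mode $k$, two traceless symmetric directions, with weight $\lambda_{{\rm shape},k}=2\hbar^2(x_k^2+1)$; total multiplicity $2N$. 3. Negative-parity cross-mode sectors: for each unordered pair $k<l$, two independent directions with weight $\lambda_{-,kl}=2\hbar^2(x_kx_l-1)$; total multiplicity $N(N-1)$. 4. Positive-parity cross-mode sectors: for each unordered pair $k<l$, two independent directions with weight $\lambda_{+,kl}=2\hbar^2(x_kx_l+1)$; total multiplicity $N(N-1)$. The multiplicities sum to $N+2N+2N(N-1)=N(2N+1)=\dim\operatorname{Sym}(2N)$. (II) For general $\Sigma=SDS^{\mathsf T}$ these are the classwise weights in the Williamson-adapted cotangent frame. The quadratic forms at $\Sigma$ and $D$ are related by an invertible congruence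 and therefore have the same inertia and nullity (although their ordinary eigenvalues relative to a fixed trace-orthonormal basis need not coincide). (III) Let $\mathcal P=\{k:x_k=1\}$ and $m=|\mathcal P|$. Then $$\dim\ker g_{\rm B}^*=m^2 .$$ In the Williamson-adapted frame, the kernel consists of one local scalar direction for every $k\in\mathcal P$, together with two negative-parity cross-mode directions for every unordered pair $k<l$ with $k,l\in\mathcal P$. All remaining sectors are strictly positive; in particular $\lambda_{{\rm shape},k}\ge4\hbar^2$ and $\lambda_{+,kl}\ge4\hbar^2$. Thus the Bures covariance cometric is nondegenerate in the faithful interior (all $x_k>1$) and loses rank precisely when at least one symplectic eigenvalue reaches the Williamson floor $\hbar/2$.
   Context: $\operatorname{Sym}(n)$ is the space of real symmetric $n\times n$ matrices, with trace pairing $\langle P,Q\rangle=\operatorname{Tr}(PQ)$. $J=\begin{pmatrix}0&1\\-1&0\end{pmatrix}$, $\Omega=\bigoplus_{k=1}^NJ$, and $\operatorname{Sp}(2N,\mathbb R)=\{S:S\Omega S^{\mathsf T}=\Omega\}$. An admissible covariance matrix is a real symmetric positive definite $2N\times2N$ matrix $\Sigma$ with $\Sigma+\frac{i\hbar}{2}\Omega\ge0$, equivalently all symplectic eigenvalues $\nu_k\ge\hbar/2$. The dual Bures form (cometric) on symmetric covectors is $$g_{\rm B}^*(\Sigma;P,P)=8\operatorname{Tr}(P\Sigma P\Sigma)+2\hbar^2\operatorname{Tr}(P\Omega P\Omega)=\operatorname{Tr}\bigl(P\,\mathcal G_{{\rm B},\Sigma}(P)\bigr).$$ The Williamson-adapted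 cotangent frame representative of a covector $P$ at $\Sigma=SDS^{\mathsf T}$ is $\widetilde P=S^{\mathsf T}PS$. Writing $P\in\operatorname{Sym}(2N)$ in $2\times2$ blocks $P_{kl}$ (with $P_{lk}=P_{kl}^{\mathsf T}$): a local scalar sector is $P_{kk}\in\mathbb R\,\mathbb 1_2$, other blocks zero; a local traceless sector is $P_{kk}$ symmetric traceless, other blocks zero; a cross-mode sector for $k<l$ has $P_{kl}=A$, $P_{lk}=A^{\mathsf T}$, other blocks zero, and it has negative parity if $JAJ=-A$ (i.e. $A\in\operatorname{span}\{\mathbb 1_2,J\}$) and positive parity if $JAJ=A$ (i.e. $A\in\operatorname{span}\{\begin{pmatrix}0&1\\1&0\end{pmatrix},\begin{pmatrix}1&0\\0&-1\end{pmatrix}\}$). *)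

theory Defs
  imports "HOL-Analysis.Analysis"
begin

text \<open>
  The modes are the elements of a finite linearly ordered type \<open>'n\<close>, so \<open>N = CARD('n)\<close>.
  A \<open>2N \<times> 2N\<close> matrix is indexed by pairs \<open>(k, i)\<close> of a mode \<open>k\<close> and a position
  \<open>i :: 2\<close> inside the \<open>2 \<times> 2\<close> block of that mode.
\<close>

type_synonym 'n mode_matrix = "real^('n \<times> 2)^('n \<times> 2)"

definition J :: "real^2^2" where
  "J = vector [vector [0, 1], vector [-1, 0]]"

definition block :: "'n::finite mode_matrix \<Rightarrow> 'n \<Rightarrow> 'n \<Rightarrow> real^2^2" where
  "block P k l = (\<chi> i j. P $ (k, i) $ (l, j))"

definition block_diag :: "('n::finite \<Rightarrow> real^2^2) \<Rightarrow> 'n mode_matrix" where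
  "block_diag B = (\<chi> p q. if fst p = fst q then B (fst p) $ snd p $ snd q else 0)"

definition Omega :: "'n::finite mode_matrix" where
  "Omega = block_diag (\<lambda>k. J)"

definition williamson_diag :: "('n::finite \<Rightarrow> real) \<Rightarrow> 'n mode_matrix" where
  "williamson_diag \<nu> = block_diag (\<lambda>k. \<nu> k *\<^sub>R mat 1)"

definition symplectic :: "'n::finite mode_matrix \<Rightarrow> bool" where
  "symplectic S \<longleftrightarrow> S ** Omega ** transpose S = Omega"

definition Sym :: "(real^'m^'m) set" where
  "Sym = {P. transpose P = P}"

definition positive_definite :: "real^'m^'m \<Rightarrow> bool" where
  "positive_definite M \<longleftrightarrow> (\<forall>v. v \<noteq> 0 \<longrightarrow> 0 < v \<bullet> (M *v v))"

definition hermitian_psd :: "complex^'m^'m \<Rightarrow> bool" where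
  "hermitian_psd M \<longleftrightarrow>
     (\<forall>i j. M $ j $ i = cnj (M $ i $ j)) \<and>
     (\<forall>z. 0 \<le> Re (\<Sum>i\<in>UNIV. cnj (z $ i) * (M *v z) $ i))"

definition admissible :: "real \<Rightarrow> 'n::finite mode_matrix \<Rightarrow> bool" where
  "admissible hbar \<Sigma> \<longleftrightarrow>
     \<Sigma> \<in> Sym \<and> positive_definite \<Sigma> \<and>
     hermitian_psd (\<chi> p q. complex_of_real (\<Sigma> $ p $ q)
                          + \<i> * complex_of_real (hbar / 2) * complex_of_real (Omega $ p $ q))"

definition bures_cometric :: "real \<Rightarrow> 'n::finite mode_matrix \<Rightarrow> 'n mode_matrix \<Rightarrow> real" where
  "bures_cometric hbar \<Sigma> P =
     8 * trace (P ** \<Sigma> ** P ** \<Sigma>) + 2 * hbar\<^sup>2 * trace (P ** Omega ** P ** Omega)"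

definition bures_operator ::
    "real \<Rightarrow> 'n::finite mode_matrix \<Rightarrow> 'n mode_matrix \<Rightarrow> 'n mode_matrix" where
  "bures_operator hbar \<Sigma> P =
     8 *\<^sub>R (\<Sigma> ** P ** \<Sigma>) + (2 * hbar\<^sup>2) *\<^sub>R (Omega ** P ** Omega)"

definition frame_rep :: "'n::finite mode_matrix \<Rightarrow> 'n mode_matrix \<Rightarrow> 'n mode_matrix" where
  "frame_rep S P = transpose S ** P ** S"

definition trace_represents ::
    "(real^'m^'m) set \<Rightarrow> (real^'m^'m \<Rightarrow> real^'m^'m) \<Rightarrow> (real^'m^'m \<Rightarrow> real) \<Rightarrow> bool" where
  "trace_represents V G q \<longleftrightarrow>
     linear G \<and> G ` V \<subseteq> V \<and>
     (\<forall>P\<in>V. \<forall>Q\<in>V. trace (P ** G Q) = trace (G P ** Q)) \<and>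
     (\<forall>P\<in>V. q P = trace (P ** G P))"

definition polar :: "('v::real_vector \<Rightarrow> real) \<Rightarrow> 'v \<Rightarrow> 'v \<Rightarrow> real" where
  "polar q u v = (q (u + v) - q u - q v) / 2"

text \<open>The kernel of a quadratic form is the radical of its polar form, not its zero set.\<close>

definition form_kernel :: "'v::real_vector set \<Rightarrow> ('v \<Rightarrow> real) \<Rightarrow> 'v set" where
  "form_kernel V q = {u \<in> V. \<forall>v\<in>V. polar q u v = 0}"

definition positive_index :: "'v::euclidean_space set \<Rightarrow> ('v \<Rightarrow> real) \<Rightarrow> nat" where
  "positive_index V q =
     Max {dim W | W. subspace W \<and> W \<subseteq> V \<and> (\<forall>w\<in>W. w \<noteq> 0 \<longrightarrow> 0 < q w)}"

definition inertia :: "'v::euclidean_space set \<Rightarrow> ('v \<Rightarrow> real) \<Rightarrow> nat \<times> nat \<times> nat" where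
  "inertia V q =
     (positive_index V q, positive_index V (\<lambda>v. - q v), dim (form_kernel V q))"

definition eigenvalues_on :: "'v::real_vector set \<Rightarrow> ('v \<Rightarrow> 'v) \<Rightarrow> real set" where
  "eigenvalues_on V G = {c. \<exists>v\<in>V. v \<noteq> 0 \<and> G v = c *\<^sub>R v}"

definition direct_sum_of :: "'v::real_vector set \<Rightarrow> 'i set \<Rightarrow> ('i \<Rightarrow> 'v set) \<Rightarrow> bool" where
  "direct_sum_of V I W \<longleftrightarrow>
     finite I \<and> subspace V \<and> (\<forall>i\<in>I. subspace (W i) \<and> W i \<subseteq> V) \<and>
     (\<forall>v\<in>V. \<exists>!f. (\<forall>i\<in>I. f i \<in> W i) \<and> (\<forall>i. i \<notin> I \<longrightarrow> f i = 0) \<and> (\<Sum>i\<in>I. f i) = v)"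

datatype 'n sector = Radial 'n | Shape 'n | CrossNeg 'n 'n | CrossPos 'n 'n

definition radial_labels :: "'n sector set" where
  "radial_labels = range Radial"

definition shape_labels :: "'n sector set" where
  "shape_labels = range Shape"

definition cross_neg_labels :: "'n::linorder sector set" where
  "cross_neg_labels = {CrossNeg k l | k l. k < l}"

definition cross_pos_labels :: "'n::linorder sector set" where
  "cross_pos_labels = {CrossPos k l | k l. k < l}"

definition sector_labels :: "'n::linorder sector set" where
  "sector_labels = radial_labels \<union> shape_labels \<union> cross_neg_labels \<union> cross_pos_labels"

definition floor_labels :: "'n::linorder set \<Rightarrow> 'n sector set" where
  "floor_labels A = {Radial k | k. k \<in> A} \<union> {CrossNeg k l | k l. k \<in> A \<and> l \<in> A \<and> k < l}"

definition supported_on :: "('n::finite \<times> 'n) set \<Rightarrow> 'n mode_matrix \<Rightarrow> bool" where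
  "supported_on B P \<longleftrightarrow> (\<forall>a b. (a, b) \<notin> B \<longrightarrow> block P a b = 0)"

text \<open>Membership in \<open>Sym\<close> makes diagonal blocks symmetric and gives \<open>P\<^sub>l\<^sub>k = P\<^sub>k\<^sub>l\<^sup>T\<close>.\<close>

primrec sector_space :: "'n::finite sector \<Rightarrow> 'n mode_matrix set" where
  "sector_space (Radial k) =
     {P \<in> Sym. supported_on {(k, k)} P \<and> (\<exists>c. block P k k = c *\<^sub>R mat 1)}"
| "sector_space (Shape k) =
     {P \<in> Sym. supported_on {(k, k)} P \<and> trace (block P k k) = 0}"
| "sector_space (CrossNeg k l) =
     {P \<in> Sym. supported_on {(k, l), (l, k)} P \<and> J ** block P k l ** J = - block P k l}"
| "sector_space (CrossPos k l) =
     {P \<in> Sym. supported_on {(k, l), (l, k)} P \<and> J ** block P k l ** J = block P k l}"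

primrec sector_weight :: "real \<Rightarrow> ('n \<Rightarrow> real) \<Rightarrow> 'n sector \<Rightarrow> real" where
  "sector_weight hbar x (Radial k) = 2 * hbar\<^sup>2 * ((x k)\<^sup>2 - 1)"
| "sector_weight hbar x (Shape k) = 2 * hbar\<^sup>2 * ((x k)\<^sup>2 + 1)"
| "sector_weight hbar x (CrossNeg k l) = 2 * hbar\<^sup>2 * (x k * x l - 1)"
| "sector_weight hbar x (CrossPos k l) = 2 * hbar\<^sup>2 * (x k * x l + 1)"

end

theory Submission
  imports Defs
begin

text \<open>
  Every sector is cut out of \<open>Sym(2N)\<close> by a block support and by an eigenvalue \<open>\<epsilon> = \<plusminus>1\<close> of the
  involution \<open>P \<mapsto> \<Omega> P \<Omega>\<close>. On a sector supported on the blocks \<open>(k, l)\<close> and \<open>(l, k)\<close>, the term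
  \<open>D P D\<close> contributes \<open>\<nu>\<^sub>k \<nu>\<^sub>l\<close> and the term \<open>\<Omega> P \<Omega>\<close> contributes \<open>\<epsilon>\<close>, which gives all four weights
  \<open>2 \<hbar>\<^sup>2 (x\<^sub>k x\<^sub>l + \<epsilon>)\<close> at once; a weight vanishes exactly when \<open>\<epsilon> = -1\<close> and \<open>x\<^sub>k = x\<^sub>l = 1\<close>.
  Since \<open>S \<Omega> S\<^sup>T = \<Omega>\<close>, the forms at \<open>\<Sigma> = S D S\<^sup>T\<close> and \<open>D\<close> differ by the congruence
  \<open>P \<mapsto> S\<^sup>T P S\<close>, so kernel and inertia can be computed at \<open>D\<close>. The bound \<open>x\<^sub>k \<ge> 1\<close> comes from testing
  \<open>\<Sigma> + (i\<hbar>/2) \<Omega> \<ge> 0\<close> on the preimage under \<open>S\<^sup>T\<close> of \<open>e + i f\<close>, with \<open>e, f\<close> the basis of mode \<open>k\<close>.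
\<close>

section \<open>Direct sums and quadratic forms\<close>

text \<open>Each \<open>W i\<close> is closed under addition and scaling, so all terms of a linear
  combination that come from the same \<open>W i\<close> can be merged into a single summand per
  index.\<close>

lemma span_UN_subspaces:
  fixes W :: "'i \<Rightarrow> 'v::real_vector set"
  assumes K: "finite K" and W: "\<And>i. i \<in> K \<Longrightarrow> subspace (W i)"
  shows "span (\<Union>i\<in>K. W i) = {\<Sum>i\<in>K. f i | f. \<forall>i\<in>K. f i \<in> W i}" (is "_ = ?R")
proof
  have "subspace ?R"
    unfolding subspace_def
  proof (intro conjI ballI allI)
    show "0 \<in> ?R"
      by (rule CollectI, rule exI[of _ "\<lambda>_. 0"]) (auto simp: subspace_0 W)
  next
    fix x y assume "x \<in> ?R" "y \<in> ?R"
    then obtain f g where "\<forall>i\<in>K. f i \<in> W i" "x = sum f K" "\<forall>i\<in>K. g i \<in> W i" "y = sum g K"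
      by blast
    then show "x + y \<in> ?R"
      by (intro CollectI exI[of _ "\<lambda>i. f i + g i"]) (auto simp: sum.distrib subspace_add W)
  next
    fix c x assume "x \<in> ?R"
    then obtain f where "\<forall>i\<in>K. f i \<in> W i" "x = sum f K"
      by blast
    then show "c *\<^sub>R x \<in> ?R"
      by (intro CollectI exI[of _ "\<lambda>i. c *\<^sub>R f i"]) (auto simp: scaleR_sum_right subspace_scale W)
  qed
  moreover have "(\<Union>i\<in>K. W i) \<subseteq> ?R"
  proof
    fix x assume "x \<in> (\<Union>i\<in>K. W i)"
    then obtain i where i: "i \<in> K" "x \<in> W i"
      by blast
    then show "x \<in> ?R"
      by (intro CollectI exI[of _ "\<lambda>j. if j = i then x else 0"])
        (use K in \<open>auto simp: subspace_0 W\<close>)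
  qed
  ultimately show "span (\<Union>i\<in>K. W i) \<subseteq> ?R"
    by (rule span_minimal[rotated])
  show "?R \<subseteq> span (\<Union>i\<in>K. W i)"
  proof clarify
    fix f assume "\<forall>i\<in>K. f i \<in> W i"
    then show "sum f K \<in> span (\<Union>i\<in>K. W i)"
      by (intro span_sum span_base) blast
  qed
qed

text \<open>Uniqueness in \<open>direct_sum_of\<close> concerns families that vanish outside
  \<open>I\<close>. Cutting \<open>f\<close> and \<open>g\<close> off outside \<open>I\<close> makes
  it applicable to families with arbitrary values there.\<close>

lemma direct_sum_of_unique:
  assumes "direct_sum_of V I W" and "\<And>i. i \<in> I \<Longrightarrow> f i \<in> W i" and "\<And>i. i \<in> I \<Longrightarrow> g i \<in> W i"
    and "(\<Sum>i\<in>I. f i) = (\<Sum>i\<in>I. g i)" and "i \<in> I"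
  shows "f i = g i"
proof -
  have W: "finite I" "subspace V" "\<And>i. i \<in> I \<Longrightarrow> W i \<subseteq> V"
    and ex: "\<And>v. v \<in> V \<Longrightarrow> \<exists>!f. (\<forall>i\<in>I. f i \<in> W i) \<and> (\<forall>i. i \<notin> I \<longrightarrow> f i = 0) \<and> (\<Sum>i\<in>I. f i) = v"
    using assms(1) unfolding direct_sum_of_def by auto
  have "(\<Sum>i\<in>I. g i) \<in> V"
    using W assms(3) by (intro subspace_sum) auto
  from ex[OF this] obtain h where
    h: "\<And>f'. (\<forall>i\<in>I. f' i \<in> W i) \<and> (\<forall>i. i \<notin> I \<longrightarrow> f' i = 0) \<and> (\<Sum>i\<in>I. f' i) = (\<Sum>i\<in>I. g i) \<Longrightarrow> f' = h"
    by (rule ex1E) blast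
  have "(\<lambda>i. if i \<in> I then f i else 0) = h" "(\<lambda>i. if i \<in> I then g i else 0) = h"
    by (rule h; use assms(2-4) in simp)+
  then have "(\<lambda>i. if i \<in> I then f i else 0) = (\<lambda>i. if i \<in> I then g i else 0)"
    by simp
  from fun_cong[OF this, of i] show ?thesis
    using assms(5) by simp
qed

lemma direct_sum_of_decompose:
  assumes "direct_sum_of V I W" and "v \<in> V"
  obtains f where "\<And>i. i \<in> I \<Longrightarrow> f i \<in> W i" and "v = (\<Sum>i\<in>I. f i)"
proof -
  have "\<exists>!f. (\<forall>i\<in>I. f i \<in> W i) \<and> (\<forall>i. i \<notin> I \<longrightarrow> f i = 0) \<and> (\<Sum>i\<in>I. f i) = v"
    using assms unfolding direct_sum_of_def by simp
  then show ?thesis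
    using that by blast
qed

lemma direct_sum_of_span:
  assumes "direct_sum_of V I W"
  shows "span (\<Union>i\<in>I. W i) = V"
proof -
  have "subspace V" "(\<Union>i\<in>I. W i) \<subseteq> V"
    using assms unfolding direct_sum_of_def by auto
  moreover have "v \<in> span (\<Union>i\<in>I. W i)" if v: "v \<in> V" for v
  proof -
    obtain f where f: "\<And>i. i \<in> I \<Longrightarrow> f i \<in> W i" "v = (\<Sum>i\<in>I. f i)"
      by (rule direct_sum_of_decompose[OF assms v]) blast
    show ?thesis
      unfolding f(2) by (rule span_sum, rule span_base) (use f(1) in blast)
  qed
  ultimately show ?thesis
    by (intro antisym span_minimal) auto
qed

text \<open>Induction on \<open>K\<close>: a vector common to \<open>W j\<close> and the span of the
  earlier spaces has two decompositions, one concentrated at \<open>j\<close> and one spread over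
  \<open>K\<close>. Uniqueness makes it zero, so dimensions add.\<close>

lemma dim_span_direct_sum:
  fixes W :: "'i \<Rightarrow> 'v::euclidean_space set"
  assumes ds: "direct_sum_of V I W" and "K \<subseteq> I"
  shows "dim (span (\<Union>i\<in>K. W i)) = (\<Sum>i\<in>K. dim (W i))"
proof -
  have I: "finite I" and W: "\<And>i. i \<in> I \<Longrightarrow> subspace (W i)"
    using ds unfolding direct_sum_of_def by auto
  have "finite K"
    using I assms(2) finite_subset by blast
  then show ?thesis
    using assms(2)
  proof (induction K rule: finite_induct)
    case (insert j K)
    have K: "K \<subseteq> I" "j \<in> I" "finite K"
      using insert by auto
    have "x = 0" if x: "x \<in> W j" "x \<in> span (\<Union>i\<in>K. W i)" for x
    proof -
      obtain f where f: "\<forall>i\<in>K. f i \<in> W i" "x = (\<Sum>i\<in>K. f i)"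
        using x(2) K W by (subst (asm) span_UN_subspaces) auto
      let ?g = "\<lambda>i. if i = j then x else 0" and ?h = "\<lambda>i. if i \<in> K then f i else 0"
      have "?g j = ?h j"
      proof (rule direct_sum_of_unique[where f = ?g and g = ?h, OF ds _ _ _ K(2)])
        show "(\<Sum>i\<in>I. if i = j then x else 0) = (\<Sum>i\<in>I. if i \<in> K then f i else 0)"
          using I K f by (simp add: sum.inter_restrict[symmetric] Int_absorb1)
      qed (use W x f K in \<open>auto simp: subspace_0\<close>)
      then show ?thesis
        using insert by simp
    qed
    then have "W j \<inter> span (\<Union>i\<in>K. W i) = {0}"
      using W[OF K(2)] by (auto simp: subspace_0 span_zero)
    moreover have "span (\<Union>i\<in>insert j K. W i) = {x + y |x y. x \<in> W j \<and> y \<in> span (\<Union>i\<in>K. W i)}"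
      using W[OF K(2)] by (simp add: span_Un span_eq_iff[THEN iffD2])
    ultimately show ?case
      using dim_sums_Int[OF W[OF K(2)] subspace_span, of "\<Union>i\<in>K. W i"] insert
      by simp
  qed simp
qed

text \<open>Applying \<open>G\<close> to the decomposition of a kernel vector yields components
  \<open>w i *\<^sub>R f i\<close> with sum zero. Uniqueness kills each of them, so only components
  of weight zero survive. Weights may coincide between different indices.\<close>

lemma kernel_diagonal_on_direct_sum:
  assumes ds: "direct_sum_of V I W" and G: "linear G"
    and w: "\<And>i v. i \<in> I \<Longrightarrow> v \<in> W i \<Longrightarrow> G v = w i *\<^sub>R v"
  shows "{v \<in> V. G v = 0} = span (\<Union>i\<in>{i\<in>I. w i = 0}. W i)"
proof -
  have I: "finite I" and V: "subspace V" and W: "\<And>i. i \<in> I \<Longrightarrow> subspace (W i)" "\<And>i. i \<in> I \<Longrightarrow> W i \<subseteq> V"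
    using ds unfolding direct_sum_of_def by auto
  have "{v \<in> V. G v = 0} \<subseteq> span (\<Union>i\<in>{i\<in>I. w i = 0}. W i)"
  proof
    fix v assume v: "v \<in> {v \<in> V. G v = 0}"
    then obtain f where f: "\<And>i. i \<in> I \<Longrightarrow> f i \<in> W i" "v = (\<Sum>i\<in>I. f i)"
      using direct_sum_of_decompose[OF ds, of v] by auto
    have "(\<Sum>i\<in>I. w i *\<^sub>R f i) = (\<Sum>i\<in>I. 0)"
      using v f w by (simp add: linear_sum[OF G])
    then have "w i *\<^sub>R f i = 0" if "i \<in> I" for i
      by (rule direct_sum_of_unique[where f = "\<lambda>i. w i *\<^sub>R f i" and g = "\<lambda>_. 0", OF ds _ _ _ that, rotated 2])
        (use W(1) f(1) in \<open>auto intro: subspace_0 subspace_scale\<close>)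
    then have "f i \<in> span (\<Union>i\<in>{i\<in>I. w i = 0}. W i)" if "i \<in> I" for i
      using that f(1)[OF that] by (cases "f i = 0") (auto simp: span_zero intro!: span_base)
    then show "v \<in> span (\<Union>i\<in>{i\<in>I. w i = 0}. W i)"
      unfolding f(2) by (rule span_sum)
  qed
  moreover have "subspace {v \<in> V. G v = 0}"
    using V unfolding subspace_def
    by (auto simp: linear_0[OF G] linear_add[OF G] linear_scale[OF G])
  ultimately show ?thesis
    using W w by (intro antisym span_minimal) auto
qed

section \<open>Injective linear maps: dimension, signature and kernel of forms\<close>

lemma dim_range_linear_inj:
  fixes f :: "'a::euclidean_space \<Rightarrow> 'b::euclidean_space"
  assumes "linear f" and "inj f"
  shows "dim (range f) = DIM('a)"
  using dim_image_eq[OF assms(1), of UNIV] assms(2) by simp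

lemma positive_index_congruence:
  fixes q q' :: "'v::euclidean_space \<Rightarrow> real"
  assumes L: "linear L" and bij: "bij_betw L V V" and V: "subspace V"
    and q: "\<And>v. v \<in> V \<Longrightarrow> q v = q' (L v)"
  shows "positive_index V q = positive_index V q'"
proof -
  have inj: "inj_on L V" and im: "L ` V = V"
    using bij by (auto simp: bij_betw_def)
  \<comment> \<open>The two sets under \<open>Max\<close> are equal: \<open>L\<close> carries
    positive subspaces to positive subspaces of the same dimension, and preimages do the converse.
    Nothing about \<open>Max\<close> itself is then required.\<close>
  have "{dim W | W. subspace W \<and> W \<subseteq> V \<and> (\<forall>w\<in>W. w \<noteq> 0 \<longrightarrow> 0 < q w)}
      = {dim W | W. subspace W \<and> W \<subseteq> V \<and> (\<forall>w\<in>W. w \<noteq> 0 \<longrightarrow> 0 < q' w)}" (is "?A = ?B")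
  proof
    show "?A \<subseteq> ?B"
    proof clarify
      fix W assume W: "subspace W" "W \<subseteq> V" and pos: "\<forall>w\<in>W. w \<noteq> 0 \<longrightarrow> 0 < q w"
      have "dim W = dim (L ` W)"
        using W inj by (subst dim_image_eq[OF L]) (auto simp: span_eq_iff[THEN iffD2] intro: inj_on_subset)
      moreover have "\<forall>w\<in>L ` W. w \<noteq> 0 \<longrightarrow> 0 < q' w"
        using pos W q linear_0[OF L] by fastforce
      ultimately show "\<exists>W'. dim W = dim W' \<and> subspace W' \<and> W' \<subseteq> V \<and> (\<forall>w\<in>W'. w \<noteq> 0 \<longrightarrow> 0 < q' w)"
        using W im linear_subspace_image[OF L W(1)] by blast
    qed
    show "?B \<subseteq> ?A"
    proof clarify
      fix W assume W: "subspace W" "W \<subseteq> V" and pos: "\<forall>w\<in>W. w \<noteq> 0 \<longrightarrow> 0 < q' w"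
      \<comment> \<open>The preimage is cut down to \<open>V\<close> because \<open>L\<close> is
        known to be injective only there.\<close>
      define U where "U = {v \<in> V. L v \<in> W}"
      have U: "subspace U"
        using V W(1) unfolding U_def subspace_def
        by (auto simp: linear_0[OF L] linear_add[OF L] linear_scale[OF L])
      have "L ` U = W"
        using W im unfolding U_def by (auto simp: image_iff)
      then have "dim W = dim U"
        using U inj dim_image_eq[OF L, of U] by (auto simp: U_def span_eq_iff[THEN iffD2] intro: inj_on_subset)
      moreover have "\<forall>w\<in>U. w \<noteq> 0 \<longrightarrow> 0 < q w"
      proof (intro ballI impI)
        fix w assume w: "w \<in> U" "w \<noteq> 0"
        then have "L w \<noteq> 0"
          using inj_onD[OF inj, of w 0] subspace_0[OF V] linear_0[OF L] unfolding U_def by auto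
        then show "0 < q w"
          using w pos q unfolding U_def by auto
      qed
      ultimately show "\<exists>W'. dim W = dim W' \<and> subspace W' \<and> W' \<subseteq> V \<and> (\<forall>w\<in>W'. w \<noteq> 0 \<longrightarrow> 0 < q w)"
        using U unfolding U_def by blast
    qed
  qed
  then show ?thesis
    unfolding positive_index_def by simp
qed

text \<open>The polar form is built from values of the form at \<open>u\<close>, \<open>v\<close>
  and \<open>u + v\<close>, so a linear congruence transports it. Since \<open>L\<close> maps onto
  \<open>V\<close>, testing against all \<open>L v\<close> is the same as testing against all of
  \<open>V\<close>.\<close>

lemma form_kernel_congruence:
  assumes L: "linear L" and bij: "bij_betw L V V" and V: "subspace V"
    and q: "\<And>v. v \<in> V \<Longrightarrow> q v = q' (L v)"
  shows "L ` form_kernel V q = form_kernel V q'"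
proof -
  have im: "L ` V = V"
    using bij by (auto simp: bij_betw_def)
  have "polar q u v = polar q' (L u) (L v)" if "u \<in> V" "v \<in> V" for u v
    using that V by (simp add: polar_def q linear_add[OF L] subspace_add)
  then have eq: "(\<forall>v\<in>V. polar q u v = 0) \<longleftrightarrow> (\<forall>v\<in>V. polar q' (L u) v = 0)" if "u \<in> V" for u
    using that by (subst (2) im[symmetric]) simp
  have "form_kernel V q' = {w \<in> L ` V. \<forall>v\<in>V. polar q' w v = 0}"
    unfolding form_kernel_def im ..
  also have "\<dots> = L ` {u \<in> V. \<forall>v\<in>V. polar q' (L u) v = 0}"
    by blast
  also have "{u \<in> V. \<forall>v\<in>V. polar q' (L u) v = 0} = form_kernel V q"
    unfolding form_kernel_def by (rule Collect_cong) (metis eq)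
  finally show ?thesis ..
qed

lemma inertia_congruence:
  fixes q q' :: "'v::euclidean_space \<Rightarrow> real"
  assumes L: "linear L" and bij: "bij_betw L V V" and V: "subspace V"
    and q: "\<And>v. v \<in> V \<Longrightarrow> q v = q' (L v)"
  shows "inertia V q = inertia V q'"
proof -
  have "form_kernel V q \<subseteq> V"
    unfolding form_kernel_def by auto
  then have "span (form_kernel V q) \<subseteq> V"
    using V by (rule span_minimal)
  then have "inj_on L (span (form_kernel V q))"
    using bij by (auto simp: bij_betw_def intro: inj_on_subset)
  then have "dim (L ` form_kernel V q) = dim (form_kernel V q)"
    by (rule dim_image_eq[OF L])
  moreover have "L ` form_kernel V q = form_kernel V q'"
    by (rule form_kernel_congruence[where L = L]) (use L bij V q in auto)
  moreover have "positive_index V q = positive_index V q'"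
    by (rule positive_index_congruence[where L = L]) (use L bij V q in auto)
  moreover have "positive_index V (\<lambda>v. - q v) = positive_index V (\<lambda>v. - q' v)"
    by (rule positive_index_congruence[where L = L]) (use L bij V q in auto)
  ultimately show ?thesis
    unfolding inertia_def by simp
qed

text \<open>The square \<open>A \<times> A\<close> splits into the pairs with \<open>k < l\<close>,
  their mirror image and the diagonal. Stating twice the count avoids division.\<close>

lemma two_card_ordered_pairs:
  fixes A :: "'a::{finite,linorder} set"
  shows "2 * card {(k, l). k \<in> A \<and> l \<in> A \<and> k < l} = card A * (card A - 1)"
proof -
  let ?L = "{(k, l). k \<in> A \<and> l \<in> A \<and> k < l}"
  have "A \<times> A = (?L \<union> prod.swap ` ?L) \<union> (\<lambda>k. (k, k)) ` A"
    by (auto simp: image_iff)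
  then have "card (A \<times> A) = card ((?L \<union> prod.swap ` ?L) \<union> (\<lambda>k. (k, k)) ` A)"
    by simp
  also have "\<dots> = card (?L \<union> prod.swap ` ?L) + card ((\<lambda>k. (k, k)) ` A)"
    by (rule card_Un_disjoint) auto
  also have "card (?L \<union> prod.swap ` ?L) = card ?L + card (prod.swap ` ?L)"
    by (rule card_Un_disjoint) auto
  also have "card (prod.swap ` ?L) = card ?L"
    by (rule card_image) auto
  also have "card ((\<lambda>k. (k, k)) ` A) = card A"
    by (rule card_image) (auto simp: inj_on_def)
  finally show ?thesis
    by (simp add: card_cartesian_product diff_mult_distrib2)
qed

section \<open>Sectors\<close>

lemma matrix_add_rdistrib: "((A + B) ** C) = (A ** C) + (B ** C)"
  by (vector matrix_matrix_mult_def sum.distrib[symmetric] field_simps)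

lemma linear_sandwich: "linear (\<lambda>P :: real^'m^'m. A ** P ** B)"
  by (intro linearI)
    (simp_all add: matrix_add_ldistrib matrix_add_rdistrib matrix_scalar_ac scalar_matrix_assoc)

lemma linear_transpose: "linear (transpose :: real^'m^'n \<Rightarrow> real^'n^'m)"
  by (intro linearI) (simp_all add: transpose_def vec_eq_iff)

lemma trace_scaleR: "trace (c *\<^sub>R M) = c * trace (M :: real^'m^'m)"
  by (simp add: trace_def sum_distrib_left)

lemma trace_sum: "trace (\<Sum>i\<in>I. f i) = (\<Sum>i\<in>I. trace (f i :: real^'m^'m))"
  by (simp add: trace_def sum.swap[of _ I])

text \<open>On symmetric matrices the trace pairing agrees with the Euclidean inner product of the
  entries. This supplies the definiteness behind the kernel and positivity arguments below.\<close>

lemma trace_mult_self_Sym: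
  assumes "P \<in> Sym"
  shows "trace (P ** P) = P \<bullet> P"
proof -
  have "P $ i $ j = P $ j $ i" for i j
    using assms by (auto simp: Sym_def transpose_def vec_eq_iff)
  then show ?thesis
    by (simp add: trace_def matrix_matrix_mult_def inner_vec_def)
qed

lemma subspace_Sym: "subspace Sym"
proof -
  have "Sym = {P. transpose P - P = 0}"
    by (auto simp: Sym_def)
  also have "subspace \<dots>"
    by (intro linear_subspace_kernel linear_compose_sub linear_transpose linear_id[unfolded id_def])
  finally show ?thesis .
qed

lemma mode_matrix_eq_iff:
  fixes P Q :: "'n::finite mode_matrix"
  shows "P = Q \<longleftrightarrow> (\<forall>a b. P $ (a, 1) $ (b, 1) = Q $ (a, 1) $ (b, 1) \<and> P $ (a, 1) $ (b, 2) = Q $ (a, 1) $ (b, 2) \<and>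
    P $ (a, 2) $ (b, 1) = Q $ (a, 2) $ (b, 1) \<and> P $ (a, 2) $ (b, 2) = Q $ (a, 2) $ (b, 2))"
  by (simp add: vec_eq_iff forall_2) blast

lemma sum_UNIV_prod: "(\<Sum>p\<in>UNIV. f p) = (\<Sum>a\<in>UNIV. \<Sum>i\<in>UNIV. f (a, i))"
  by (simp add: sum.cartesian_product)

lemma block_diag_mult_entry:
  "(block_diag B ** P) $ (a, i) $ q = B a $ i $ 1 * P $ (a, 1) $ q + B a $ i $ 2 * P $ (a, 2) $ q"
  unfolding matrix_matrix_mult_def vec_lambda_beta sum_UNIV_prod
  by (subst sum.mono_neutral_right[of UNIV "{a}"]) (auto simp: block_diag_def UNIV_2)

lemma mult_block_diag_entry:
  "(P ** block_diag B) $ p $ (b, j) = P $ p $ (b, 1) * B b $ 1 $ j + P $ p $ (b, 2) * B b $ 2 $ j"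
  unfolding matrix_matrix_mult_def vec_lambda_beta sum_UNIV_prod
  by (subst sum.mono_neutral_right[of UNIV "{b}"]) (auto simp: block_diag_def UNIV_2)

lemma J_entries: "J $ 1 $ 1 = 0" "J $ 1 $ 2 = 1" "J $ 2 $ 1 = - 1" "J $ 2 $ 2 = 0"
  by (simp_all add: J_def)

text \<open>The sandwich acts on every block separately by \<open>M \<mapsto> J ** M ** J\<close>.
  It moves no block, so it is compatible with block supports.\<close>

lemma Omega_sandwich_entries:
  fixes P :: "'n::finite mode_matrix"
  shows "(Omega ** P ** Omega) $ (a, 1) $ (b, 1) = - P $ (a, 2) $ (b, 2)"
    and "(Omega ** P ** Omega) $ (a, 1) $ (b, 2) = P $ (a, 2) $ (b, 1)"
    and "(Omega ** P ** Omega) $ (a, 2) $ (b, 1) = P $ (a, 1) $ (b, 2)"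
    and "(Omega ** P ** Omega) $ (a, 2) $ (b, 2) = - P $ (a, 1) $ (b, 1)"
  by (simp_all add: Omega_def mult_block_diag_entry block_diag_mult_entry J_entries)

lemma williamson_sandwich_entry:
  "(williamson_diag \<nu> ** P ** williamson_diag \<nu>) $ (a, i) $ (b, j) = \<nu> a * \<nu> b * P $ (a, i) $ (b, j)"
  using exhaust_2[of i] exhaust_2[of j]
  by (auto simp: williamson_diag_def mult_block_diag_entry block_diag_mult_entry mat_def)

lemma Omega_Omega: "Omega ** Omega = - (mat 1 :: 'n::finite mode_matrix)"
  by (simp add: mode_matrix_eq_iff Omega_def block_diag_mult_entry J_entries)
    (simp add: block_diag_def J_entries mat_def)

lemma transpose_Omega: "transpose Omega = - (Omega :: 'n::finite mode_matrix)"
  by (simp add: mode_matrix_eq_iff transpose_def Omega_def block_diag_def J_entries)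

lemma transpose_williamson_diag: "transpose (williamson_diag \<nu>) = williamson_diag \<nu>"
  by (auto simp: mode_matrix_eq_iff transpose_def williamson_diag_def block_diag_def mat_def)

lemma mem_Sym_iff:
  "P \<in> Sym \<longleftrightarrow> (\<forall>a b i j. P $ (a, i) $ (b, j) = P $ (b, j) $ (a, i))"
  by (auto simp: Sym_def transpose_def vec_eq_iff)

section \<open>Sectors as parity eigenspaces with a block support\<close>

primrec sector_support :: "'n sector \<Rightarrow> ('n \<times> 'n) set" where
  "sector_support (Radial k) = {(k, k)}"
| "sector_support (Shape k) = {(k, k)}"
| "sector_support (CrossNeg k l) = {(k, l), (l, k)}"
| "sector_support (CrossPos k l) = {(k, l), (l, k)}"

text \<open>The signs are the eigenvalues of \<open>M \<mapsto> J ** M ** J\<close> on the blocks of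
  a sector: \<open>J ** J = - mat 1\<close> gives -1 on scalar blocks, while symmetric traceless
  blocks are fixed.\<close>

primrec sector_sign :: "'n sector \<Rightarrow> real" where
  "sector_sign (Radial k) = - 1"
| "sector_sign (Shape k) = 1"
| "sector_sign (CrossNeg k l) = - 1"
| "sector_sign (CrossPos k l) = 1"

lemma sector_sign_square: "sector_sign s * sector_sign s = 1"
  by (cases s) auto

lemma sector_support_sym: "(a, b) \<in> sector_support s \<longleftrightarrow> (b, a) \<in> sector_support s"
  by (cases s) auto

lemma supported_on_iff:
  "supported_on B P \<longleftrightarrow> (\<forall>a b i j. (a, b) \<notin> B \<longrightarrow> P $ (a, i) $ (b, j) = 0)"
  by (auto simp: supported_on_def block_def vec_eq_iff)

lemma J_sandwich_entries:
  "(J ** M ** J) $ 1 $ 1 = - M $ 2 $ 2" "(J ** M ** J) $ 1 $ 2 = M $ 2 $ 1"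
  "(J ** M ** J) $ 2 $ 1 = M $ 1 $ 2" "(J ** M ** J) $ 2 $ 2 = - M $ 1 $ 1"
  by (simp_all add: matrix_matrix_mult_def UNIV_2 J_entries)

text \<open>One pair of entry equations covers all four kinds. On a diagonal block symmetry supplies
  the rest: sign -1 forces the off-diagonal entry to equal its own negative, leaving a scalar block,
  and sign 1 leaves exactly the trace condition. For cross sectors the block at
  \<open>(l, k)\<close> is the transpose and inherits the equations.\<close>

lemma mem_sector_space_iff:
  "P \<in> sector_space s \<longleftrightarrow> P \<in> Sym \<and> supported_on (sector_support s) P \<and>
     (\<forall>a b. P $ (a, 2) $ (b, 2) = - sector_sign s * P $ (a, 1) $ (b, 1) \<and>
            P $ (a, 2) $ (b, 1) = sector_sign s * P $ (a, 1) $ (b, 2))"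
  (is "_ \<longleftrightarrow> _ \<and> ?supp \<and> ?parity")
proof (cases "P \<in> Sym \<and> ?supp")
  case True
  then have sym: "\<And>a b i j. P $ (a, i) $ (b, j) = P $ (b, j) $ (a, i)"
    and supp: "\<And>a b i j. (a, b) \<notin> sector_support s \<Longrightarrow> P $ (a, i) $ (b, j) = 0"
    by (auto simp: mem_Sym_iff supported_on_iff)
  \<comment> \<open>Outside the support all entries vanish and the equations read
    \<open>0 = 0\<close>.\<close>
  have parity: "?parity \<longleftrightarrow> (\<forall>(a, b)\<in>sector_support s.
      P $ (a, 2) $ (b, 2) = - sector_sign s * P $ (a, 1) $ (b, 1) \<and>
      P $ (a, 2) $ (b, 1) = sector_sign s * P $ (a, 1) $ (b, 2))" (is "_ = ?local")
    using supp by fastforce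
  have "P \<in> sector_space s \<longleftrightarrow> ?local"
  proof (cases s)
    case (Radial k)
    have "P $ (k, 1) $ (k, 2) = P $ (k, 2) $ (k, 1)"
      by (rule sym)
    then show ?thesis
      using True Radial
      by (auto simp: block_def vec_eq_iff forall_2 mat_def)
  next
    case (Shape k)
    have "P $ (k, 1) $ (k, 2) = P $ (k, 2) $ (k, 1)"
      by (rule sym)
    then show ?thesis
      using True Shape
      by (auto simp: block_def trace_def UNIV_2)
  next
    case (CrossNeg k l)
    have "P $ (k, i) $ (l, j) = P $ (l, j) $ (k, i)" for i j
      by (rule sym)
    then show ?thesis
      using True CrossNeg
      by (auto simp: vec_eq_iff forall_2 J_sandwich_entries) (auto simp: block_def)
  next
    case (CrossPos k l)
    have "P $ (k, i) $ (l, j) = P $ (l, j) $ (k, i)" for i j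
      by (rule sym)
    then show ?thesis
      using True CrossPos
      by (auto simp: vec_eq_iff forall_2 J_sandwich_entries) (auto simp: block_def)
  qed
  then show ?thesis
    using True parity by simp
next
  case False
  then show ?thesis
    by (cases s) auto
qed

declare sector_space.simps [simp del]

text \<open>The four scalar equations of a block come in two pairs. As \<open>c\<close> is 1 or -1,
  multiplying one equation of a pair by \<open>c\<close> gives the other.\<close>

lemma Omega_sandwich_eq_iff:
  fixes P :: "'n::finite mode_matrix"
  assumes "c * c = 1"
  shows "Omega ** P ** Omega = c *\<^sub>R P \<longleftrightarrow>
    (\<forall>a b. P $ (a, 2) $ (b, 2) = - c * P $ (a, 1) $ (b, 1) \<and> P $ (a, 2) $ (b, 1) = c * P $ (a, 1) $ (b, 2))"
proof -
  have "Omega ** P ** Omega = c *\<^sub>R P \<longleftrightarrow> (\<forall>a b.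
      - P $ (a, 2) $ (b, 2) = c * P $ (a, 1) $ (b, 1) \<and> P $ (a, 2) $ (b, 1) = c * P $ (a, 1) $ (b, 2) \<and>
      P $ (a, 1) $ (b, 2) = c * P $ (a, 2) $ (b, 1) \<and> - P $ (a, 1) $ (b, 1) = c * P $ (a, 2) $ (b, 2))"
    by (simp add: mode_matrix_eq_iff Omega_sandwich_entries)
  also have "\<dots> \<longleftrightarrow> (\<forall>a b. P $ (a, 2) $ (b, 2) = - c * P $ (a, 1) $ (b, 1) \<and>
      P $ (a, 2) $ (b, 1) = c * P $ (a, 1) $ (b, 2))"
  proof -
    have "c = 1 \<or> c = -1"
      using assms by (simp add: square_eq_1_iff)
    then show ?thesis
      by (intro all_cong1) auto
  qed
  finally show ?thesis .
qed

lemma sector_space_eq: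
  "sector_space s = {P \<in> Sym. supported_on (sector_support s) P \<and> Omega ** P ** Omega = sector_sign s *\<^sub>R P}"
  by (auto simp: mem_sector_space_iff Omega_sandwich_eq_iff[OF sector_sign_square])

section \<open>Sector projections and the direct sum\<close>

lemma supported_on_subspace: "subspace {P. supported_on B P}"
  by (auto simp: subspace_def supported_on_iff)

lemma subspace_sector_space: "subspace (sector_space s)"
proof -
  have "sector_space s = Sym \<inter> {P. supported_on (sector_support s) P}
      \<inter> {P. Omega ** P ** Omega - sector_sign s *\<^sub>R P = 0}"
    by (auto simp: sector_space_eq)
  also have "subspace \<dots>"
    by (intro subspace_inter subspace_Sym supported_on_subspace linear_subspace_kernel linear_compose_sub
        linear_sandwich linear_scale_self)
  finally show ?thesis .
qed

text \<open>The map \<open>P \<mapsto> Omega ** P ** Omega\<close> is an involution. Half of the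
  identity plus the sign times the involution is its spectral projection, here cut off to the block
  support.\<close>

definition sector_proj :: "'n::finite sector \<Rightarrow> 'n mode_matrix \<Rightarrow> 'n mode_matrix" where
  "sector_proj s P = (\<chi> p q. if (fst p, fst q) \<in> sector_support s
     then (P $ p $ q + sector_sign s * (Omega ** P ** Omega) $ p $ q) / 2 else 0)"

lemma linear_sector_proj: "linear (sector_proj s)"
proof -
  have "(Omega ** (P + Q) ** Omega) = Omega ** P ** Omega + Omega ** Q ** Omega"
    "(Omega ** (c *\<^sub>R P) ** Omega) = c *\<^sub>R (Omega ** P ** Omega)" for P Q :: "'a mode_matrix" and c
    using linear_sandwich[of Omega Omega] by (auto simp: linear_iff)
  then show ?thesis
    by (intro linearI) (auto simp: sector_proj_def vec_eq_iff algebra_simps add_divide_distrib)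
qed

lemma Omega_sandwich_Sym:
  assumes "P \<in> Sym"
  shows "Omega ** P ** Omega \<in> Sym"
  using assms by (simp add: Sym_def matrix_transpose_mul transpose_Omega matrix_mul_assoc)
    (simp add: matrix_matrix_mult_def vec_eq_iff sum_negf)

lemma sector_proj_mem:
  assumes "P \<in> Sym"
  shows "sector_proj s P \<in> sector_space s"
  unfolding mem_sector_space_iff
proof (intro conjI allI)
  have sign: "sector_sign s = 1 \<or> sector_sign s = -1"
    by (cases s) auto
  have sym: "P $ (a, i) $ (b, j) = P $ (b, j) $ (a, i)" for a b i j
    using assms by (simp add: mem_Sym_iff)
  show "sector_proj s P \<in> Sym"
    using assms Omega_sandwich_Sym[OF assms] by (auto simp: mem_Sym_iff sector_proj_def sector_support_sym[of _ _ s])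
  show "supported_on (sector_support s) (sector_proj s P)"
    by (auto simp: supported_on_iff sector_proj_def)
  show "sector_proj s P $ (a, 2) $ (b, 2) = - sector_sign s * sector_proj s P $ (a, 1) $ (b, 1)" for a b
    using sign by (auto simp: sector_proj_def Omega_sandwich_entries field_simps)
  show "sector_proj s P $ (a, 2) $ (b, 1) = sector_sign s * sector_proj s P $ (a, 1) $ (b, 2)" for a b
    using sign by (auto simp: sector_proj_def Omega_sandwich_entries field_simps)
qed

lemma sector_proj_same:
  assumes "P \<in> sector_space s"
  shows "sector_proj s P = P"
  using assms sector_sign_square[of s]
  by (auto simp: sector_space_eq sector_proj_def vec_eq_iff supported_on_iff mult.assoc[symmetric])

text \<open>This is where the convention \<open>k < l\<close> on cross labels matters:
  \<open>CrossNeg k l\<close> and \<open>CrossNeg l k\<close> denote the same space, and only one of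
  them is a label.\<close>

lemma sector_labels_cases:
  assumes "s \<in> sector_labels" "t \<in> sector_labels" "s \<noteq> t"
  shows "sector_support s \<inter> sector_support t = {} \<or>
    (sector_support s = sector_support t \<and> sector_sign s = - sector_sign t)"
  using assms
  by (auto simp: sector_labels_def radial_labels_def shape_labels_def cross_neg_labels_def cross_pos_labels_def)

lemma sector_proj_other:
  assumes "s \<in> sector_labels" "t \<in> sector_labels" "s \<noteq> t" and P: "P \<in> sector_space t"
  shows "sector_proj s P = 0"
proof -
  have "(a, b) \<notin> sector_support t \<Longrightarrow> P $ (a, i) $ (b, j) = 0" for a b i j
    using P by (simp add: sector_space_eq supported_on_iff)
  moreover have "Omega ** P ** Omega = sector_sign t *\<^sub>R P"
    using P by (simp add: sector_space_eq)
  ultimately show ?thesis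
    using sector_labels_cases[OF assms(1-3)] sector_sign_square[of t]
    by (fastforce simp: sector_proj_def vec_eq_iff mult.assoc[symmetric])
qed

text \<open>This makes the projections complete: at a given block position just two of them act,
  their \<open>Omega ** P ** Omega\<close> terms cancel, and the two halves of \<open>P\<close> add
  up.\<close>

lemma labels_with_support:
  fixes a b :: "'n::linorder"
  obtains s t where "{r \<in> sector_labels. (a, b) \<in> sector_support r} = {s, t}"
    and "sector_sign s = - 1" and "sector_sign t = 1"
proof -
  consider "a = b" | "a < b" | "b < a"
    by fastforce
  then show ?thesis
  proof cases
    case 1
    then show ?thesis
      by (intro that[of "Radial a" "Shape a"])
        (auto simp: sector_labels_def radial_labels_def shape_labels_def cross_neg_labels_def cross_pos_labels_def)
  next
    case 2
    then show ?thesis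
      by (intro that[of "CrossNeg a b" "CrossPos a b"])
        (auto simp: sector_labels_def radial_labels_def shape_labels_def cross_neg_labels_def cross_pos_labels_def)
  next
    case 3
    then show ?thesis
      by (intro that[of "CrossNeg b a" "CrossPos b a"])
        (auto simp: sector_labels_def radial_labels_def shape_labels_def cross_neg_labels_def cross_pos_labels_def)
  qed
qed

lemma finite_sector_labels: "finite (sector_labels :: 'n::{finite,linorder} sector set)"
proof -
  have "sector_labels \<subseteq> range Radial \<union> range Shape \<union> range (\<lambda>(k, l). CrossNeg k l)
      \<union> (range (\<lambda>(k, l). CrossPos k l) :: 'n sector set)"
    by (auto simp: sector_labels_def radial_labels_def shape_labels_def cross_neg_labels_def cross_pos_labels_def)
  then show ?thesis
    by (rule finite_subset) simp
qed

lemma sum_sector_proj: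
  fixes P :: "'n::{finite,linorder} mode_matrix"
  shows "(\<Sum>s\<in>sector_labels. sector_proj s P) = P"
proof -
  have "(\<Sum>s\<in>sector_labels. sector_proj s P $ (a, i) $ (b, j)) = P $ (a, i) $ (b, j)" for a b i j
  proof -
    obtain s t :: "'n sector" where st: "{r \<in> sector_labels. (a, b) \<in> sector_support r} = {s, t}"
      "sector_sign s = - 1" "sector_sign t = 1"
      by (rule labels_with_support)
    have "(\<Sum>r\<in>sector_labels. sector_proj r P $ (a, i) $ (b, j))
        = (\<Sum>r\<in>{r \<in> sector_labels. (a, b) \<in> sector_support r}.
            (P $ (a, i) $ (b, j) + sector_sign r * (Omega ** P ** Omega) $ (a, i) $ (b, j)) / 2)"
      by (simp add: sector_proj_def sum.inter_filter finite_sector_labels)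
    also have "\<dots> = P $ (a, i) $ (b, j)"
    proof -
      have "s \<noteq> t"
        using st by auto
      then show ?thesis
        unfolding st(1) by (simp add: st(2,3) field_simps)
    qed
    finally show ?thesis .
  qed
  then show ?thesis
    by (simp add: vec_eq_iff)
qed

text \<open>Existence is the completeness of the projections. For uniqueness,
  \<open>sector_proj s\<close> is applied to an arbitrary decomposition: it fixes the component at
  \<open>s\<close> and annihilates all others.\<close>

lemma direct_sum_sectors:
  "direct_sum_of (Sym :: 'n::{finite,linorder} mode_matrix set) sector_labels sector_space"
  unfolding direct_sum_of_def
proof (intro conjI ballI)
  fix P :: "'n mode_matrix" assume P: "P \<in> Sym"
  show "\<exists>!f. (\<forall>s\<in>sector_labels. f s \<in> sector_space s) \<and> (\<forall>s. s \<notin> sector_labels \<longrightarrow> f s = 0) \<and>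
      (\<Sum>s\<in>sector_labels. f s) = P"
  proof (rule ex1I)
    show "(\<forall>s\<in>sector_labels. (if s \<in> sector_labels then sector_proj s P else 0) \<in> sector_space s) \<and>
      (\<forall>s. s \<notin> sector_labels \<longrightarrow> (if s \<in> sector_labels then sector_proj s P else 0) = 0) \<and>
      (\<Sum>s\<in>sector_labels. if s \<in> sector_labels then sector_proj s P else 0) = P"
      using P by (auto simp: sector_proj_mem sum_sector_proj cong: sum.cong)
  next
    fix f assume f: "(\<forall>s\<in>sector_labels. f s \<in> sector_space s) \<and> (\<forall>s. s \<notin> sector_labels \<longrightarrow> f s = 0) \<and>
      (\<Sum>s\<in>sector_labels. f s) = P"
    show "f = (\<lambda>s. if s \<in> sector_labels then sector_proj s P else 0)"
    proof
      fix s
      have "f s = sector_proj s P" if s: "s \<in> sector_labels"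
      proof -
        have "sector_proj s P = (\<Sum>t\<in>sector_labels. sector_proj s (f t))"
          using f by (auto simp: linear_sum[OF linear_sector_proj, symmetric])
        also have "\<dots> = (\<Sum>t\<in>sector_labels. if t = s then f s else 0)"
          using f s by (intro sum.cong) (auto simp: sector_proj_same sector_proj_other)
        finally show ?thesis
          using s by (simp add: finite_sector_labels)
      qed
      then show "f s = (if s \<in> sector_labels then sector_proj s P else 0)"
        using f by simp
    qed
  qed
next
  fix s :: "'n sector"
  show "sector_space s \<subseteq> Sym"
    by (auto simp: sector_space_eq)
qed (simp_all add: finite_sector_labels subspace_Sym subspace_sector_space)

section \<open>Dimensions and multiplicities\<close>

lemmas label_defs = sector_labels_def radial_labels_def shape_labels_def cross_neg_labels_def cross_pos_labels_def

text \<open>As for the other sectors below, the space is the range of a linear map from its free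
  entries. A left inverse reads them off the first row of the block.\<close>

lemma dim_Radial: "dim (sector_space (Radial (k :: 'n::finite))) = 1"
proof -
  define f :: "real \<Rightarrow> 'n mode_matrix" where
    "f c = (\<chi> p q. if fst p = k \<and> fst q = k \<and> snd p = snd q then c else 0)" for c
  have entry: "f c $ (a, i) $ (b, j) = (if a = k \<and> b = k \<and> i = j then c else 0)" for c a b i j
    by (simp add: f_def)
  have "linear f"
    by (intro linearI) (auto simp: f_def vec_eq_iff)
  moreover have "inj f"
    by (rule inj_on_inverseI[where g = "\<lambda>P. P $ (k, 1) $ (k, 1)"]) (simp add: entry)
  moreover have "range f = sector_space (Radial k)"
  proof (intro equalityI subsetI)
    fix P assume "P \<in> range f"
    then show "P \<in> sector_space (Radial k)"
      by (auto simp: mem_sector_space_iff mem_Sym_iff supported_on_iff entry)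
  next
    fix P assume "P \<in> sector_space (Radial k)"
    then have P: "P \<in> Sym" "\<And>a b i j. \<not> (a = k \<and> b = k) \<Longrightarrow> P $ (a, i) $ (b, j) = 0"
      "P $ (k, 2) $ (k, 2) = P $ (k, 1) $ (k, 1)" "P $ (k, 2) $ (k, 1) = - P $ (k, 1) $ (k, 2)"
      by (auto simp: mem_sector_space_iff supported_on_iff)
    then have "P $ (k, 1) $ (k, 2) = P $ (k, 2) $ (k, 1)"
      unfolding mem_Sym_iff by blast
    then have "P = f (P $ (k, 1) $ (k, 1))"
      using P(2-) by (auto simp: mode_matrix_eq_iff entry)
    then show "P \<in> range f"
      by blast
  qed
  ultimately show ?thesis
    using dim_range_linear_inj[of f] by simp
qed

lemma dim_Shape: "dim (sector_space (Shape (k :: 'n::finite))) = 2"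
proof -
  define f :: "real \<times> real \<Rightarrow> 'n mode_matrix" where
    "f z = (\<chi> p q. if fst p = k \<and> fst q = k then
      (if snd p \<noteq> snd q then snd z else if snd p = 1 then fst z else - fst z) else 0)" for z
  have entry: "f z $ (a, i) $ (b, j) = (if a = k \<and> b = k then
      (if i \<noteq> j then snd z else if i = 1 then fst z else - fst z) else 0)" for z a b i j
    by (simp add: f_def)
  have "linear f"
    by (intro linearI) (auto simp: f_def vec_eq_iff)
  moreover have "inj f"
    by (rule inj_on_inverseI[where g = "\<lambda>P. (P $ (k, 1) $ (k, 1), P $ (k, 1) $ (k, 2))"]) (simp add: entry)
  moreover have "range f = sector_space (Shape k)"
  proof (intro equalityI subsetI)
    fix P assume "P \<in> range f"
    then show "P \<in> sector_space (Shape k)"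
      by (auto simp: mem_sector_space_iff mem_Sym_iff supported_on_iff entry)
  next
    fix P assume "P \<in> sector_space (Shape k)"
    then have P: "\<And>a b i j. \<not> (a = k \<and> b = k) \<Longrightarrow> P $ (a, i) $ (b, j) = 0"
      "P $ (k, 2) $ (k, 2) = - P $ (k, 1) $ (k, 1)" "P $ (k, 2) $ (k, 1) = P $ (k, 1) $ (k, 2)"
      by (auto simp: mem_sector_space_iff supported_on_iff)
    then have "P = f (P $ (k, 1) $ (k, 1), P $ (k, 1) $ (k, 2))"
      by (auto simp: mode_matrix_eq_iff entry)
    then show "P \<in> range f"
      by blast
  qed
  ultimately show ?thesis
    using dim_range_linear_inj[of f] by simp
qed

lemma dim_Cross:
  fixes k l :: "'n::finite"
  assumes "k \<noteq> l" and s: "s = CrossNeg k l \<or> s = CrossPos k l"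
  shows "dim (sector_space s) = 2"
proof -
  define h :: "real \<times> real \<Rightarrow> 2 \<Rightarrow> 2 \<Rightarrow> real" where
    "h z i j = (if i = 1 then (if j = 1 then fst z else snd z)
      else (if j = 1 then sector_sign s * snd z else - sector_sign s * fst z))" for z i j
  \<comment> \<open>The block at \<open>(k, l)\<close> has free first row \<open>z\<close> and a
    second row dictated by the sign. The block at \<open>(l, k)\<close> is its transpose, hence the
    swapped indices. The branches do not collide because \<open>k \<noteq> l\<close>.\<close>
  define f :: "real \<times> real \<Rightarrow> 'n mode_matrix" where
    "f z = (\<chi> p q. if fst p = k \<and> fst q = l then h z (snd p) (snd q)
      else if fst p = l \<and> fst q = k then h z (snd q) (snd p) else 0)" for z
  have entry: "f z $ (a, i) $ (b, j) = (if a = k \<and> b = l then h z i j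
      else if a = l \<and> b = k then h z j i else 0)" for z a b i j
    by (simp add: f_def)
  have sign: "sector_sign s = 1 \<or> sector_sign s = -1"
    using s by auto
  have supp: "sector_support s = {(k, l), (l, k)}"
    using s by auto
  have "linear f"
  proof -
    have "h (z + w) i j = h z i j + h w i j" "h (c *\<^sub>R z) i j = c * h z i j" for z w c i j
      by (simp_all add: h_def distrib_left)
    note h = this
    \<comment> \<open>Sums and factors are moved through the nested conditionals by rewriting, which
      avoids a case split over all indices.\<close>
    have if_add: "(if P then x + y else if Q then z + w else 0)
        = (if P then x else if Q then z else 0) + (if P then y else if Q then w else 0)"
      and if_mult: "(if P then r * x else if Q then r * z else 0) = r * (if P then x else if Q then z else 0)"
      for P Q and x y z w r :: real
      by simp_all
    show ?thesis
      by (intro linearI vec_eq_iff[THEN iffD2] allI)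
        (simp_all only: f_def h vec_lambda_beta vector_add_component vector_scaleR_component
          real_scaleR_def if_add if_mult)
  qed
  moreover have "inj f"
    by (rule inj_on_inverseI[where g = "\<lambda>P. (P $ (k, 1) $ (l, 1), P $ (k, 1) $ (l, 2))"])
      (simp add: entry h_def)
  moreover have "range f = sector_space s"
  proof (intro equalityI subsetI)
    fix P assume "P \<in> range f"
    then show "P \<in> sector_space s"
      using sign assms(1)
      by (auto simp: mem_sector_space_iff mem_Sym_iff supported_on_iff supp entry h_def)
  next
    fix P assume "P \<in> sector_space s"
    then have sym: "P \<in> Sym" and P: "\<And>a b i j. (a, b) \<notin> {(k, l), (l, k)} \<Longrightarrow> P $ (a, i) $ (b, j) = 0"
      "P $ (k, 2) $ (l, 2) = - sector_sign s * P $ (k, 1) $ (l, 1)"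
      "P $ (k, 2) $ (l, 1) = sector_sign s * P $ (k, 1) $ (l, 2)"
      by (auto simp: mem_sector_space_iff supported_on_iff supp)
    have "P $ (l, i) $ (k, j) = P $ (k, j) $ (l, i)" for i j
      using sym unfolding mem_Sym_iff by blast
    then have "P = f (P $ (k, 1) $ (l, 1), P $ (k, 1) $ (l, 2))"
      using P assms(1) by (auto simp: mode_matrix_eq_iff entry h_def)
    then show "P \<in> range f"
      by blast
  qed
  ultimately show ?thesis
    using dim_range_linear_inj[of f] by simp
qed

lemma sum_dim_radial_labels:
  "(\<Sum>s\<in>(radial_labels :: 'n::finite sector set). dim (sector_space s)) = CARD('n)"
  by (simp add: radial_labels_def sum.reindex inj_on_def dim_Radial)

lemma sum_dim_shape_labels:
  "(\<Sum>s\<in>(shape_labels :: 'n::finite sector set). dim (sector_space s)) = 2 * CARD('n)"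
  by (simp add: shape_labels_def sum.reindex inj_on_def dim_Shape)

text \<open>Two directions per unordered pair cancel the factor in
  \<open>two_card_ordered_pairs\<close>. The set \<open>A\<close> stays general so that one count
  serves both all modes and the modes at the floor.\<close>

lemma sum_dim_Cross_within:
  fixes A :: "'n::{finite,linorder} set"
  assumes C: "C = CrossNeg \<or> C = CrossPos"
  shows "(\<Sum>s\<in>{C k l | k l. k \<in> A \<and> l \<in> A \<and> k < l}. dim (sector_space s)) = card A * (card A - 1)"
proof -
  have im: "{C k l | k l. k \<in> A \<and> l \<in> A \<and> k < l}
      = (\<lambda>(k, l). C k l) ` {(k, l). k \<in> A \<and> l \<in> A \<and> k < l}"
    by auto
  have inj: "inj_on (\<lambda>(k, l). C k l) {(k, l). k \<in> A \<and> l \<in> A \<and> k < l}"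
    by (use C in \<open>auto simp: inj_on_def\<close>)
  have "(\<Sum>p\<in>{(k, l). k \<in> A \<and> l \<in> A \<and> k < l}. dim (sector_space (case p of (k, l) \<Rightarrow> C k l)))
      = (\<Sum>p\<in>{(k, l). k \<in> A \<and> l \<in> A \<and> k < l}. 2)"
    by (rule sum.cong[OF refl]) (use C in \<open>auto intro!: dim_Cross\<close>)
  also have "\<dots> = card A * (card A - 1)"
    unfolding two_card_ordered_pairs[symmetric] by simp
  finally show ?thesis
    unfolding im sum.reindex[OF inj] o_def .
qed

lemma sum_dim_cross_neg_labels:
  "(\<Sum>s\<in>(cross_neg_labels :: 'n::{finite,linorder} sector set). dim (sector_space s)) = CARD('n) * (CARD('n) - 1)"
  using sum_dim_Cross_within[of CrossNeg "UNIV :: 'n set"] by (simp add: cross_neg_labels_def)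

lemma sum_dim_cross_pos_labels:
  "(\<Sum>s\<in>(cross_pos_labels :: 'n::{finite,linorder} sector set). dim (sector_space s)) = CARD('n) * (CARD('n) - 1)"
  using sum_dim_Cross_within[of CrossPos "UNIV :: 'n set"] by (simp add: cross_pos_labels_def)

lemma sum_dim_sector_labels:
  "(\<Sum>s\<in>(sector_labels :: 'n::{finite,linorder} sector set). dim (sector_space s))
    = CARD('n) + 2 * CARD('n) + 2 * CARD('n) * (CARD('n) - 1)"
proof -
  have fin: "finite (radial_labels :: 'n sector set)" "finite (shape_labels :: 'n sector set)"
    "finite (cross_neg_labels :: 'n sector set)" "finite (cross_pos_labels :: 'n sector set)"
    by (rule finite_subset[OF _ finite_sector_labels], force simp: sector_labels_def)+
  have "(\<Sum>s\<in>(sector_labels :: 'n sector set). dim (sector_space s))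
    = (\<Sum>s\<in>(radial_labels :: 'n sector set). dim (sector_space s))
    + (\<Sum>s\<in>(shape_labels :: 'n sector set). dim (sector_space s))
    + (\<Sum>s\<in>(cross_neg_labels :: 'n sector set). dim (sector_space s))
    + (\<Sum>s\<in>(cross_pos_labels :: 'n sector set). dim (sector_space s))"
    unfolding sector_labels_def
    by (subst sum.union_disjoint, use fin in simp, use fin in simp, force simp: label_defs)+ simp
  then show ?thesis
    by (simp add: sum_dim_radial_labels sum_dim_shape_labels sum_dim_cross_neg_labels sum_dim_cross_pos_labels)
qed

text \<open>One direction per mode and two per pair give \<open>m + m * (m - 1)\<close>, which is
  the square \<open>m\<^sup>2\<close>.\<close>

lemma sum_dim_floor_labels:
  fixes A :: "'n::{finite,linorder} set"
  shows "(\<Sum>s\<in>floor_labels A. dim (sector_space s)) = (card A)\<^sup>2"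
proof -
  have fin: "finite (floor_labels A)"
    by (rule finite_subset[OF _ finite_sector_labels]) (auto simp: floor_labels_def label_defs)
  have "(\<Sum>s\<in>{Radial k | k. k \<in> A}. dim (sector_space s)) = card A"
    by (simp add: Setcompr_eq_image sum.reindex inj_on_def dim_Radial)
  then have "(\<Sum>s\<in>floor_labels A. dim (sector_space s)) = card A + card A * (card A - 1)"
    using fin unfolding floor_labels_def
    by (subst sum.union_disjoint) (auto simp: sum_dim_Cross_within)
  \<comment> \<open>The empty set is split off because \<open>card A - 1\<close> is a truncated
    subtraction.\<close>
  then show ?thesis
    by (cases "card A") (simp_all add: power2_eq_square)
qed

lemma sum_multiplicities: "N + 2 * N + 2 * N * (N - 1) = N * (2 * N + 1)" for N :: nat
  by (cases N) (simp_all add: algebra_simps)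

lemma dim_Sym_mode_matrix:
  "dim (Sym :: 'n::{finite,linorder} mode_matrix set) = CARD('n) * (2 * CARD('n) + 1)"
proof -
  have "dim (Sym :: 'n mode_matrix set) = (\<Sum>s\<in>(sector_labels :: 'n sector set). dim (sector_space s))"
    unfolding direct_sum_of_span[OF direct_sum_sectors, symmetric]
    by (rule dim_span_direct_sum[OF direct_sum_sectors order_refl])
  then show ?thesis
    by (simp only: sum_dim_sector_labels sum_multiplicities)
qed

section \<open>Sector weights and orthogonality at the Williamson representative\<close>

lemma sector_weight_eq:
  assumes "(a, b) \<in> sector_support s"
  shows "sector_weight hbar x s = 2 * hbar\<^sup>2 * (x a * x b + sector_sign s)"
  using assms by (cases s) (auto simp: power2_eq_square)

lemma bures_operator_sector:
  assumes P: "P \<in> sector_space s" and x: "\<And>k. x k = 2 * \<nu> k / hbar" and "hbar \<noteq> 0"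
  shows "bures_operator hbar (williamson_diag \<nu>) P = sector_weight hbar x s *\<^sub>R P"
proof -
  have eig: "Omega ** P ** Omega = sector_sign s *\<^sub>R P"
    and supp: "\<And>a b i j. (a, b) \<notin> sector_support s \<Longrightarrow> P $ (a, i) $ (b, j) = 0"
    using P by (auto simp: sector_space_eq supported_on_iff)
  have "bures_operator hbar (williamson_diag \<nu>) P $ (a, i) $ (b, j) = sector_weight hbar x s * P $ (a, i) $ (b, j)"
    for a b i j
  proof (cases "(a, b) \<in> sector_support s")
    case True
    \<comment> \<open>Substituting \<open>\<nu> k = hbar * x k / 2\<close> turns the coefficient 8
      into the common prefactor \<open>2 * hbar\<^sup>2\<close>.\<close>
    have "8 * (\<nu> a * \<nu> b) = 2 * hbar\<^sup>2 * (x a * x b)"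
      using \<open>hbar \<noteq> 0\<close> by (simp add: x field_simps power2_eq_square)
    then show ?thesis
      by (simp add: bures_operator_def williamson_sandwich_entry eig sector_weight_eq[OF True] algebra_simps)
  next
    case False
    then show ?thesis
      by (simp add: bures_operator_def williamson_sandwich_entry eig supp)
  qed
  then show ?thesis
    by (simp add: vec_eq_iff)
qed

lemma Omega_Omega_scaleR: "Omega ** Omega = (- 1) *\<^sub>R (mat 1 :: 'n::finite mode_matrix)"
  by (simp add: Omega_Omega)

text \<open>With disjoint supports every product of entries in the trace vanishes. With opposite
  signs, sandwiching both factors preserves the trace of the product, since
  \<open>Omega ** Omega = - mat 1\<close> enters twice, yet multiplies it by -1.\<close>

lemma trace_sector_orthogonal:
  assumes st: "s \<in> sector_labels" "t \<in> sector_labels" "s \<noteq> t"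
    and P: "P \<in> sector_space s" and Q: "Q \<in> sector_space t"
  shows "trace (P ** Q) = 0"
proof -
  have suppP: "\<And>a b i j. (a, b) \<notin> sector_support s \<Longrightarrow> P $ (a, i) $ (b, j) = 0"
    and eigP: "Omega ** P ** Omega = sector_sign s *\<^sub>R P"
    using P by (auto simp: sector_space_eq supported_on_iff)
  have suppQ: "\<And>a b i j. (a, b) \<notin> sector_support t \<Longrightarrow> Q $ (b, j) $ (a, i) = 0"
    and eigQ: "Omega ** Q ** Omega = sector_sign t *\<^sub>R Q"
    using Q by (auto simp: sector_space_eq supported_on_iff sector_support_sym[of _ _ t])
  consider "sector_support s \<inter> sector_support t = {}" | "sector_sign s = - sector_sign t"
    using sector_labels_cases[OF st] by blast
  then show ?thesis
  proof cases
    case 1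
    then have "P $ p $ q * Q $ q $ p = 0" for p q
      using suppP[of "fst p" "fst q" "snd p" "snd q"] suppQ[of "fst p" "fst q" "snd q" "snd p"] by auto
    then have "(P ** Q) $ p $ p = 0" for p
      unfolding matrix_matrix_mult_def vec_lambda_beta by (rule sum.neutral[OF ballI])
    then show ?thesis
      by (simp add: trace_def)
  next
    case 2
    have "trace ((Omega ** P ** Omega) ** (Omega ** Q ** Omega)) = - trace (Omega ** P ** (Q ** Omega))"
    proof -
      have "(Omega ** P ** Omega) ** (Omega ** Q ** Omega) = Omega ** P ** (Omega ** Omega) ** (Q ** Omega)"
        by (simp add: matrix_mul_assoc)
      also have "\<dots> = (- 1) *\<^sub>R (Omega ** P ** (Q ** Omega))"
        unfolding Omega_Omega_scaleR
        by (simp only: matrix_scalar_ac scalar_matrix_assoc[symmetric] matrix_mul_rid)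
      finally show ?thesis
        by (simp only: trace_scaleR mult_minus1)
    qed
    also have "trace (Omega ** P ** (Q ** Omega)) = trace (Omega ** (P ** Q ** Omega))"
      by (simp add: matrix_mul_assoc)
    also have "\<dots> = trace (P ** Q ** (Omega ** Omega))"
      by (subst trace_mul_sym) (simp add: matrix_mul_assoc)
    also have "P ** Q ** (Omega ** Omega) = (- 1) *\<^sub>R (P ** Q)"
      unfolding Omega_Omega_scaleR
      by (simp only: matrix_scalar_ac matrix_mul_rid)
    finally have "sector_sign s * sector_sign t * trace (P ** Q) = trace (P ** Q)"
      by (simp only: eigP eigQ trace_scaleR matrix_scalar_ac scalar_matrix_assoc[symmetric]) (simp add: mult.commute)
    then show ?thesis
      using 2 sector_sign_square[of t] by simp
  qed
qed

section \<open>Trace representation, radical and rank\<close>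

lemma linear_bures_operator: "linear (bures_operator hbar \<Sigma>)"
  unfolding bures_operator_def
  by (intro linear_compose_add linear_compose_scale_right linear_sandwich)

lemma transpose_add: "transpose (A + B) = transpose A + transpose (B :: real^'m^'n)"
  by (rule linear_add[OF linear_transpose])

lemma bures_operator_Sym:
  assumes "\<Sigma> \<in> Sym" "P \<in> Sym"
  shows "bures_operator hbar \<Sigma> P \<in> Sym"
proof -
  have "transpose (Omega ** P ** Omega) = Omega ** P ** Omega"
    using Omega_sandwich_Sym[OF assms(2)] by (simp add: Sym_def)
  moreover have "transpose (\<Sigma> ** P ** \<Sigma>) = \<Sigma> ** P ** \<Sigma>"
    using assms by (simp add: Sym_def matrix_transpose_mul matrix_mul_assoc)
  ultimately show ?thesis
    by (simp add: Sym_def bures_operator_def transpose_add transpose_scalar)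
qed

text \<open>Cyclicity of the trace. It makes both terms of the Bures operator self-adjoint at
  once.\<close>

lemma trace_mult_sandwich: "trace (P ** (M ** Q ** M)) = trace ((M ** P ** M) ** (Q :: real^'m^'m))"
proof -
  have "trace (P ** (M ** Q ** M)) = trace ((P ** M ** Q) ** M)"
    by (simp add: matrix_mul_assoc)
  also have "\<dots> = trace (M ** (P ** M ** Q))"
    by (rule trace_mul_sym)
  finally show ?thesis
    by (simp add: matrix_mul_assoc)
qed

lemma trace_represents_bures:
  assumes "\<Sigma> \<in> Sym"
  shows "trace_represents Sym (bures_operator hbar \<Sigma>) (bures_cometric hbar \<Sigma>)"
  unfolding trace_represents_def
proof (intro conjI ballI)
  fix P Q
  have distr: "trace (P ** bures_operator hbar \<Sigma> Q)
      = 8 * trace (P ** (\<Sigma> ** Q ** \<Sigma>)) + 2 * hbar\<^sup>2 * trace (P ** (Omega ** Q ** Omega))" for P Q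
    by (simp add: bures_operator_def matrix_add_ldistrib trace_add matrix_scalar_ac
        scalar_matrix_assoc[symmetric] trace_scaleR)
  have distl: "trace (bures_operator hbar \<Sigma> P ** Q)
      = 8 * trace ((\<Sigma> ** P ** \<Sigma>) ** Q) + 2 * hbar\<^sup>2 * trace ((Omega ** P ** Omega) ** Q)" for P Q
    by (simp add: bures_operator_def matrix_add_rdistrib trace_add matrix_scalar_ac
        scalar_matrix_assoc[symmetric] trace_scaleR)
  show "trace (P ** bures_operator hbar \<Sigma> Q) = trace (bures_operator hbar \<Sigma> P ** Q)"
    unfolding distr distl by (simp only: trace_mult_sandwich)
  show "bures_cometric hbar \<Sigma> P = trace (P ** bures_operator hbar \<Sigma> P)"
    unfolding distr bures_cometric_def by (simp add: matrix_mul_assoc)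
qed (use assms in \<open>auto simp: linear_bures_operator bures_operator_Sym\<close>)

text \<open>By self-adjointness the polar form is \<open>trace (G P ** Q)\<close>. As
  \<open>G P\<close> is again symmetric it may be taken as the test matrix \<open>Q\<close>, and
  definiteness of the trace pairing yields \<open>G P = 0\<close>.\<close>

lemma form_kernel_trace_represents:
  fixes G :: "real^'m^'m \<Rightarrow> real^'m^'m"
  assumes rep: "trace_represents Sym G q"
  shows "form_kernel Sym q = {P \<in> Sym. G P = 0}"
proof -
  have G: "linear G" "G ` Sym \<subseteq> Sym"
    and self: "\<And>P Q. P \<in> Sym \<Longrightarrow> Q \<in> Sym \<Longrightarrow> trace (P ** G Q) = trace (G P ** Q)"
    and q: "\<And>P. P \<in> Sym \<Longrightarrow> q P = trace (P ** G P)"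
    using rep unfolding trace_represents_def by auto
  have polar: "polar q P Q = trace (G P ** Q)" if "P \<in> Sym" "Q \<in> Sym" for P Q
  proof -
    have "P + Q \<in> Sym"
      using that subspace_add[OF subspace_Sym] by blast
    then have "q (P + Q) = q P + trace (P ** G Q) + trace (Q ** G P) + q Q"
      using that by (simp add: q linear_add[OF G(1)] matrix_add_ldistrib matrix_add_rdistrib trace_add)
    then show ?thesis
      using self[OF that] trace_mul_sym[of Q "G P"] by (simp add: polar_def)
  qed
  have "G P = 0" if P: "P \<in> Sym" "\<forall>Q\<in>Sym. polar q P Q = 0" for P
  proof -
    have "G P \<in> Sym"
      using P(1) G(2) by blast
    then have "G P \<bullet> G P = 0"
      using P polar[OF P(1)] by (simp add: trace_mult_self_Sym[symmetric])
    then show ?thesis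
      by simp
  qed
  then show ?thesis
    unfolding form_kernel_def using polar by (auto simp: trace_def)
qed

text \<open>A trivial kernel makes \<open>G\<close> injective on \<open>Sym\<close>, so the
  dimension is kept. Conversely the image of a self-adjoint map is orthogonal to its kernel, so a
  nonzero kernel element is missing from the image.\<close>

lemma dim_image_self_adjoint_less_iff:
  fixes G :: "real^'m^'m \<Rightarrow> real^'m^'m"
  assumes rep: "trace_represents Sym G q"
  shows "dim (G ` Sym) < dim (Sym :: (real^'m^'m) set) \<longleftrightarrow> form_kernel Sym q \<noteq> {0}"
proof -
  have G: "linear G" "G ` Sym \<subseteq> Sym"
    and self: "\<And>P Q. P \<in> Sym \<Longrightarrow> Q \<in> Sym \<Longrightarrow> trace (P ** G Q) = trace (G P ** Q)"
    using rep unfolding trace_represents_def by auto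
  have ker: "form_kernel Sym q = {P \<in> Sym. G P = 0}"
    by (rule form_kernel_trace_represents[OF rep])
  have zero: "0 \<in> form_kernel Sym q"
    by (simp add: ker linear_0[OF G(1)] subspace_0 subspace_Sym)
  show ?thesis
  proof
    assume less: "dim (G ` Sym) < dim (Sym :: (real^'m^'m) set)"
    show "form_kernel Sym q \<noteq> {0}"
    proof
      assume "form_kernel Sym q = {0}"
      then have "inj_on G Sym"
        using ker subspace_Sym
        by (intro linear_inj_on_iff_eq_0[OF G(1), THEN iffD2]) auto
      then show False
        using less dim_image_eq[OF G(1), of Sym] by (simp add: span_eq_iff[THEN iffD2] subspace_Sym)
    qed
  next
    assume "form_kernel Sym q \<noteq> {0}"
    then obtain U where U: "U \<in> Sym" "G U = 0" "U \<noteq> 0"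
      using zero ker by blast
    have "U \<notin> G ` Sym"
    proof
      assume "U \<in> G ` Sym"
      then obtain Q where Q: "Q \<in> Sym" "U = G Q"
        by blast
      have "U \<bullet> U = trace (U ** G Q)"
        using trace_mult_self_Sym[OF U(1)] Q(2) by simp
      also have "\<dots> = trace (G U ** Q)"
        using self U(1) Q(1) by blast
      finally show False
        using U by (simp add: trace_def)
    qed
    then have "G ` Sym \<subset> Sym"
      using G(2) U(1) by blast
    then show "dim (G ` Sym) < dim (Sym :: (real^'m^'m) set)"
      by (intro dim_psubset)
        (simp only: span_eq_iff[THEN iffD2, OF linear_subspace_image[OF G(1) subspace_Sym]]
          span_eq_iff[THEN iffD2, OF subspace_Sym])
  qed
qed

section \<open>Williamson decomposition\<close>

lemma Sym_entry:
  assumes "M \<in> Sym"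
  shows "M $ i $ j = M $ j $ i"
proof -
  have "transpose M $ i $ j = M $ i $ j"
    using assms by (simp add: Sym_def)
  then show ?thesis
    by (simp add: transpose_def)
qed

text \<open>The defining equation and \<open>Omega ** Omega = - mat 1\<close> make the negative of
  \<open>Omega ** transpose S ** Omega\<close> a right inverse. For square matrices it is then
  two-sided.\<close>

lemma symplectic_inverse:
  assumes "symplectic S"
  obtains R where "S ** R = mat 1" and "R ** S = mat 1"
proof -
  have "S ** ((- 1) *\<^sub>R (Omega ** transpose S ** Omega)) = (- 1) *\<^sub>R ((S ** Omega ** transpose S) ** Omega)"
    by (simp only: matrix_scalar_ac matrix_mul_assoc scalar_matrix_assoc[symmetric])
  also have "\<dots> = mat 1"
    using assms by (simp add: symplectic_def Omega_Omega)
  finally show ?thesis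
    using that matrix_left_right_inverse by blast
qed

lemma inner_congruence:
  "u \<bullet> ((S ** M ** transpose S) *v v) = (transpose S *v u) \<bullet> (M *v (transpose S *v v))"
  for S :: "real^'m^'m"
proof -
  have "u \<bullet> ((S ** M ** transpose S) *v v) = u \<bullet> (S *v (M *v (transpose S *v v)))"
    by (simp only: matrix_vector_mul_assoc matrix_mul_assoc)
  also have "\<dots> = (transpose S *v u) \<bullet> (M *v (transpose S *v v))"
    by (simp add: dot_lmul_matrix[symmetric])
  finally show ?thesis .
qed

text \<open>Writing \<open>z = u + i v\<close> turns complex positivity into a real inequality. The
  imaginary part of the matrix enters only through the antisymmetrized pairing of \<open>u\<close>
  and \<open>v\<close>.\<close>

lemma Re_hermitian_form:
  fixes A B :: "real^'m^'m" and z :: "complex^'m"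
  defines "u \<equiv> \<chi> p. Re (z $ p)" and "v \<equiv> \<chi> p. Im (z $ p)"
  shows "Re (\<Sum>p\<in>UNIV. cnj (z $ p) *
      ((\<chi> p q. complex_of_real (A $ p $ q) + \<i> * complex_of_real c * complex_of_real (B $ p $ q)) *v z) $ p)
    = u \<bullet> (A *v u) + v \<bullet> (A *v v) - c * (u \<bullet> (B *v v) - v \<bullet> (B *v u))"
proof -
  have "Re (\<Sum>p\<in>UNIV. cnj (z $ p) *
      ((\<chi> p q. complex_of_real (A $ p $ q) + \<i> * complex_of_real c * complex_of_real (B $ p $ q)) *v z) $ p)
    = (\<Sum>p\<in>UNIV. \<Sum>q\<in>UNIV. u $ p * (A $ p $ q * u $ q) + v $ p * (A $ p $ q * v $ q)
        - c * (u $ p * (B $ p $ q * v $ q) - v $ p * (B $ p $ q * u $ q)))"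
    by (simp add: matrix_vector_mult_def sum_distrib_left u_def v_def algebra_simps)
  also have "\<dots> = u \<bullet> (A *v u) + v \<bullet> (A *v v) - c * (u \<bullet> (B *v v) - v \<bullet> (B *v u))"
    by (simp add: matrix_vector_mult_def inner_vec_def sum_distrib_left sum.distrib sum_subtractf
        right_diff_distrib)
  finally show ?thesis .
qed

lemma williamson_diag_mult_vec: "(williamson_diag \<nu> *v a) $ (k, i) = \<nu> k * a $ (k, i)"
  unfolding matrix_vector_mult_def vec_lambda_beta sum_UNIV_prod
  using exhaust_2[of i]
  by (subst sum.mono_neutral_right[of UNIV "{k}"]) (auto simp: williamson_diag_def block_diag_def mat_def UNIV_2)

lemma Omega_mult_vec:
  "(Omega *v a) $ (k, 1) = a $ (k, 2)" "(Omega *v a) $ (k, 2) = - a $ (k, 1)"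
  unfolding matrix_vector_mult_def vec_lambda_beta sum_UNIV_prod
  by (subst sum.mono_neutral_right[of UNIV "{k}"]; auto simp: Omega_def block_diag_def J_entries UNIV_2)+

lemma inner_mode_vec: "a \<bullet> b = (\<Sum>k\<in>UNIV. a $ (k, 1) * b $ (k, 1) + a $ (k, 2) * b $ (k, 2))"
  for a b :: "real^('n::finite \<times> 2)"
  by (simp add: inner_vec_def sum_UNIV_prod UNIV_2)

lemma admissible_symplectic_eigenvalue_ge:
  assumes adm: "admissible hbar (S ** williamson_diag \<nu> ** transpose S)" and S: "symplectic S"
  shows "hbar / 2 \<le> \<nu> k"
proof -
  obtain R where R: "S ** R = mat 1" "R ** S = mat 1"
    using symplectic_inverse[OF S] .
  have ST: "transpose S *v (transpose R *v a) = a" for a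
    using arg_cong[OF R(2), of transpose]
    by (simp only: matrix_vector_mul_assoc matrix_transpose_mul transpose_mat matrix_vector_mul_lid)
  define a b :: "real^('a \<times> 2)" where "a = axis (k, 1) 1" and "b = axis (k, 2) 1"
  define z where "z = (\<chi> p. Complex ((transpose R *v a) $ p) ((transpose R *v b) $ p))"
  have z: "(\<chi> p. Re (z $ p)) = transpose R *v a" "(\<chi> p. Im (z $ p)) = transpose R *v b"
    by (simp_all add: z_def vec_eq_iff)
  have "0 \<le> Re (\<Sum>p\<in>UNIV. cnj (z $ p) *
      ((\<chi> p q. complex_of_real ((S ** williamson_diag \<nu> ** transpose S) $ p $ q)
         + \<i> * complex_of_real (hbar / 2) * complex_of_real (Omega $ p $ q)) *v z) $ p)"
    using adm unfolding admissible_def hermitian_psd_def by blast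
  also have "\<dots> = a \<bullet> (williamson_diag \<nu> *v a) + b \<bullet> (williamson_diag \<nu> *v b)
      - hbar / 2 * (a \<bullet> (Omega *v b) - b \<bullet> (Omega *v a))"
    unfolding Re_hermitian_form z inner_congruence ST
    using S[unfolded symplectic_def] inner_congruence[of _ S Omega] by (metis ST)
  \<comment> \<open>Here \<open>a \<bullet> (Omega *v b)\<close> is 1 and
    \<open>b \<bullet> (Omega *v a)\<close> is -1, so the last term is exactly \<open>hbar\<close>.
    The opposite phase of \<open>b\<close> would give \<open>2 * \<nu> k + hbar\<close> and no
    useful bound.\<close>
  also have "\<dots> = 2 * \<nu> k - hbar"
    unfolding a_def b_def by (simp add: inner_axis' williamson_diag_mult_vec Omega_mult_vec)
  finally show ?thesis
    by simp
qed

text \<open>Since \<open>williamson_diag \<nu>\<close> dominates \<open>hbar / 2\<close> times the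
  identity, the Hermitian form at real and imaginary parts \<open>a\<close>, \<open>b\<close> in the
  frame is at least \<open>hbar / 2\<close> times the squared norm of \<open>a - Omega *v b\<close>.
  The lemma serves to certify the squeezed witness below.\<close>

lemma admissible_williamson:
  fixes S :: "'n::finite mode_matrix"
  assumes S: "symplectic S" and "0 < hbar" and \<nu>: "\<And>k. hbar / 2 \<le> \<nu> k"
  shows "admissible hbar (S ** williamson_diag \<nu> ** transpose S)" (is "admissible hbar ?\<Sigma>")
proof -
  obtain R where R: "S ** R = mat 1" "R ** S = mat 1"
    using symplectic_inverse[OF S] .
  have D: "hbar / 2 * (a \<bullet> a) \<le> a \<bullet> (williamson_diag \<nu> *v a)" for a :: "real^('n \<times> 2)"
    unfolding inner_mode_vec williamson_diag_mult_vec sum_distrib_left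
  proof (rule sum_mono)
    fix k
    have "hbar / 2 * ((a $ (k, 1))\<^sup>2 + (a $ (k, 2))\<^sup>2) \<le> \<nu> k * ((a $ (k, 1))\<^sup>2 + (a $ (k, 2))\<^sup>2)"
      using \<nu> by (intro mult_right_mono) auto
    then show "hbar / 2 * (a $ (k, 1) * a $ (k, 1) + a $ (k, 2) * a $ (k, 2))
        \<le> a $ (k, 1) * (\<nu> k * a $ (k, 1)) + a $ (k, 2) * (\<nu> k * a $ (k, 2))"
      by (simp add: power2_eq_square algebra_simps)
  qed
  have sym: "?\<Sigma> \<in> Sym"
    by (simp add: Sym_def matrix_transpose_mul transpose_williamson_diag matrix_mul_assoc)
  moreover have "positive_definite ?\<Sigma>"
    unfolding positive_definite_def
  proof (intro allI impI)
    fix v :: "real^('n \<times> 2)" assume "v \<noteq> 0"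
    have "transpose R *v (transpose S *v v) = v"
      using arg_cong[OF R(1), of transpose]
      by (simp only: matrix_vector_mul_assoc matrix_transpose_mul transpose_mat matrix_vector_mul_lid)
    then have "transpose S *v v \<noteq> 0"
      using \<open>v \<noteq> 0\<close> by (metis matrix_vector_mult_0_right)
    then have "0 < hbar / 2 * ((transpose S *v v) \<bullet> (transpose S *v v))"
      using \<open>0 < hbar\<close> by (intro mult_pos_pos) simp_all
    also have "\<dots> \<le> v \<bullet> (?\<Sigma> *v v)"
      unfolding inner_congruence by (rule D)
    finally show "0 < v \<bullet> (?\<Sigma> *v v)" .
  qed
  moreover have "hermitian_psd (\<chi> p q. complex_of_real (?\<Sigma> $ p $ q)
      + \<i> * complex_of_real (hbar / 2) * complex_of_real (Omega $ p $ q))"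
    unfolding hermitian_psd_def
  proof (intro conjI allI)
    fix p q :: "'n \<times> 2"
    have "?\<Sigma> $ q $ p = ?\<Sigma> $ p $ q"
      using sym by (rule Sym_entry)
    moreover have "(Omega :: 'n mode_matrix) $ q $ p = - Omega $ p $ q"
      using arg_cong[OF transpose_Omega[where 'n = 'n], of "\<lambda>M. M $ p $ q"] by (simp add: transpose_def)
    ultimately show "(\<chi> p q. complex_of_real (?\<Sigma> $ p $ q)
          + \<i> * complex_of_real (hbar / 2) * complex_of_real (Omega $ p $ q)) $ q $ p
        = cnj ((\<chi> p q. complex_of_real (?\<Sigma> $ p $ q)
          + \<i> * complex_of_real (hbar / 2) * complex_of_real (Omega $ p $ q)) $ p $ q)"
      by simp
  next
    fix z :: "complex^('n \<times> 2)"
    define u v where "u = (\<chi> p. Re (z $ p))" and "v = (\<chi> p. Im (z $ p))"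
    define a b where "a = transpose S *v u" and "b = transpose S *v v"
    have Om: "x \<bullet> (Omega *v y) = (transpose S *v x) \<bullet> (Omega *v (transpose S *v y))" for x y :: "real^('n \<times> 2)"
      using inner_congruence[of x S Omega y] S by (simp add: symplectic_def)
    have "0 \<le> hbar / 2 * ((a - Omega *v b) \<bullet> (a - Omega *v b))"
      using \<open>0 < hbar\<close> by simp
    also have "(a - Omega *v b) \<bullet> (a - Omega *v b) = a \<bullet> a + b \<bullet> b - (a \<bullet> (Omega *v b) - b \<bullet> (Omega *v a))"
      by (simp add: inner_mode_vec Omega_mult_vec sum.distrib[symmetric] sum_subtractf[symmetric] algebra_simps)
    also have "hbar / 2 * \<dots> \<le> a \<bullet> (williamson_diag \<nu> *v a) + b \<bullet> (williamson_diag \<nu> *v b)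
        - hbar / 2 * (a \<bullet> (Omega *v b) - b \<bullet> (Omega *v a))"
      using D[of a] D[of b] by (simp add: algebra_simps)
    also have "\<dots> = Re (\<Sum>p\<in>UNIV. cnj (z $ p) *
      ((\<chi> p q. complex_of_real (?\<Sigma> $ p $ q)
         + \<i> * complex_of_real (hbar / 2) * complex_of_real (Omega $ p $ q)) *v z) $ p)"
      unfolding Re_hermitian_form u_def[symmetric] v_def[symmetric] inner_congruence Om[of u v] Om[of v u]
        a_def b_def ..
    finally show "0 \<le> Re (\<Sum>p\<in>UNIV. cnj (z $ p) *
      ((\<chi> p q. complex_of_real (?\<Sigma> $ p $ q)
         + \<i> * complex_of_real (hbar / 2) * complex_of_real (Omega $ p $ q)) *v z) $ p)" .
  qed
  ultimately show ?thesis
    unfolding admissible_def by blast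
qed

text \<open>The witness squeezes every mode of \<open>(\<hbar>/2) 1\<close> by \<open>r\<close> with \<open>r\<^sup>4 = 2\<close>: the local block
  \<open>diag(2, -1)\<close> becomes an eigenvector for \<open>5 \<hbar>\<^sup>2\<close>, whereas the unsqueezed operator only has the
  eigenvalues \<open>0\<close> and \<open>4 \<hbar>\<^sup>2\<close>.\<close>

lemma eigenvalues_not_congruence_invariant:
  assumes "0 < hbar"
  shows "\<exists>(\<Sigma> :: 'n::finite mode_matrix) S \<nu>. admissible hbar \<Sigma> \<and> symplectic S \<and>
    \<Sigma> = S ** williamson_diag \<nu> ** transpose S \<and>
    eigenvalues_on Sym (bures_operator hbar \<Sigma>) \<noteq> eigenvalues_on Sym (bures_operator hbar (williamson_diag \<nu>))"
proof -
  define r :: real where "r = root 4 2"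
  have r: "r \<noteq> 0" "r ^ 4 = 2"
    by (simp_all add: r_def)
  then have r4: "r * (r * (r * r)) = 2"
    by (simp add: power4_eq_xxxx mult.assoc)
  define S :: "'n mode_matrix" where "S = block_diag (\<lambda>_. vector [vector [r, 0], vector [0, 1 / r]])"
  define \<nu> :: "'n \<Rightarrow> real" where "\<nu> = (\<lambda>_. hbar / 2)"
  define P :: "'n mode_matrix" where "P = block_diag (\<lambda>_. vector [vector [2, 0], vector [0, - 1]])"
  let ?\<Sigma> = "S ** williamson_diag \<nu> ** transpose S"
  have "transpose S = S"
    by (simp add: mode_matrix_eq_iff transpose_def S_def block_diag_def)
  have S: "symplectic S"
    unfolding symplectic_def \<open>transpose S = S\<close> unfolding mode_matrix_eq_iff S_def
    by (simp add: mult_block_diag_entry block_diag_mult_entry) (auto simp: Omega_def block_diag_def J_entries r)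
  have \<Sigma>: "?\<Sigma> = block_diag (\<lambda>_. vector [vector [hbar / 2 * r\<^sup>2, 0], vector [0, hbar / 2 / r\<^sup>2]])"
    unfolding \<open>transpose S = S\<close> unfolding mode_matrix_eq_iff S_def
    by (simp add: mult_block_diag_entry block_diag_mult_entry)
      (auto simp: williamson_diag_def \<nu>_def mat_def block_diag_def power2_eq_square)
  \<comment> \<open>In units of \<open>hbar\<^sup>2\<close> the diagonal entries are
    \<open>8 + 2 = 10\<close> and \<open>- 1 - 4 = - 5\<close>, five times those of
    \<open>P\<close>. The values 8 and -1 rely on \<open>r ^ 4 = 2\<close>.\<close>
  have "bures_operator hbar ?\<Sigma> P = (5 * hbar\<^sup>2) *\<^sub>R P"
    unfolding \<Sigma> mode_matrix_eq_iff bures_operator_def P_def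
    by (simp add: Omega_sandwich_entries mult_block_diag_entry block_diag_mult_entry)
      (simp add: block_diag_def power2_eq_square power4_eq_xxxx field_simps r4)
  moreover have "P \<in> Sym"
    by (auto simp: Sym_def mode_matrix_eq_iff transpose_def P_def block_diag_def)
  moreover have "P \<noteq> 0"
    by (auto simp: mode_matrix_eq_iff P_def block_diag_def)
  ultimately have "5 * hbar\<^sup>2 \<in> eigenvalues_on Sym (bures_operator hbar ?\<Sigma>)"
    unfolding eigenvalues_on_def by blast
  moreover have "5 * hbar\<^sup>2 \<notin> eigenvalues_on Sym (bures_operator hbar (williamson_diag \<nu>))"
  proof
    assume "5 * hbar\<^sup>2 \<in> eigenvalues_on Sym (bures_operator hbar (williamson_diag \<nu>))"
    then obtain Q where Q: "Q \<noteq> 0" "bures_operator hbar (williamson_diag \<nu>) Q = (5 * hbar\<^sup>2) *\<^sub>R Q"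
      unfolding eigenvalues_on_def by blast
    \<comment> \<open>At \<open>hbar / 2\<close> times the identity the eigenvalue equation divided
      by \<open>hbar\<^sup>2\<close> reads \<open>2 Q + 2 Omega Q Omega = 5 Q\<close>.\<close>
    have entry: "2 * (Omega ** Q ** Omega) $ (a, i) $ (b, j) = 3 * Q $ (a, i) $ (b, j)" for a b i j
    proof -
      have "hbar\<^sup>2 * (2 * (Omega ** Q ** Omega) $ (a, i) $ (b, j)) = hbar\<^sup>2 * (3 * Q $ (a, i) $ (b, j))"
        using arg_cong[OF Q(2), of "\<lambda>M. M $ (a, i) $ (b, j)"]
        by (simp add: bures_operator_def williamson_sandwich_entry \<nu>_def power2_eq_square algebra_simps)
      then show ?thesis
        using \<open>0 < hbar\<close> by simp
    qed
    \<comment> \<open>An involution has no eigenvalue 3/2: the sandwich pairs the entries of a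
      block, and each pair yields \<open>4 q = 9 q\<close>.\<close>
    have "Q = 0"
      unfolding mode_matrix_eq_iff
    proof (intro allI)
      fix a b
      show "Q $ (a, 1) $ (b, 1) = 0 $ (a, 1) $ (b, 1) \<and> Q $ (a, 1) $ (b, 2) = 0 $ (a, 1) $ (b, 2) \<and>
          Q $ (a, 2) $ (b, 1) = 0 $ (a, 2) $ (b, 1) \<and> Q $ (a, 2) $ (b, 2) = 0 $ (a, 2) $ (b, 2)"
        using entry[of a 1 b 1] entry[of a 1 b 2] entry[of a 2 b 1] entry[of a 2 b 2]
        unfolding Omega_sandwich_entries zero_index by linarith
    qed
    with Q(1) show False ..
  qed
  moreover have "admissible hbar ?\<Sigma>"
    by (rule admissible_williamson[OF S \<open>0 < hbar\<close>]) (simp add: \<nu>_def)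
  ultimately show ?thesis
    using S by blast
qed

section \<open>Sector expansion of the form and symplectic congruence\<close>

lemma trace_sum_mult_sum:
  fixes f g :: "'i \<Rightarrow> real^'m^'m"
  shows "trace ((\<Sum>i\<in>I. f i) ** (\<Sum>j\<in>I. g j)) = (\<Sum>i\<in>I. \<Sum>j\<in>I. trace (f i ** g j))"
proof -
  have l: "(\<Sum>i\<in>I. f i) ** Y = (\<Sum>i\<in>I. f i ** Y)" for Y
    using linear_sum[OF linear_sandwich[of "mat 1" Y], of f I] by simp
  have r: "X ** (\<Sum>j\<in>I. g j) = (\<Sum>j\<in>I. X ** g j)" for X
    using linear_sum[OF linear_sandwich[of X "mat 1"], of g I] by simp
  show ?thesis
    by (simp only: l) (simp only: r trace_sum)
qed

text \<open>A Parseval identity: the operator scales each component by its weight, and trace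
  orthogonality of distinct sectors removes the mixed terms.\<close>

lemma bures_cometric_sector_sum:
  assumes x: "\<And>k. x k = 2 * \<nu> k / hbar" and "hbar \<noteq> 0"
    and f: "\<And>s. s \<in> sector_labels \<Longrightarrow> f s \<in> sector_space s"
  shows "bures_cometric hbar (williamson_diag \<nu>) (\<Sum>s\<in>sector_labels. f s)
    = (\<Sum>s\<in>sector_labels. sector_weight hbar x s * trace (f s ** f s))"
proof -
  let ?D = "williamson_diag \<nu>" and ?P = "\<Sum>s\<in>sector_labels. f s"
  have "?D \<in> Sym"
    by (simp add: Sym_def transpose_williamson_diag)
  moreover have "?P \<in> Sym"
    using f by (intro subspace_sum[OF subspace_Sym]) (auto simp: sector_space_eq)
  ultimately have "bures_cometric hbar ?D ?P = trace (?P ** bures_operator hbar ?D ?P)"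
    using trace_represents_bures[of ?D hbar] by (simp add: trace_represents_def)
  also have "bures_operator hbar ?D ?P = (\<Sum>t\<in>sector_labels. sector_weight hbar x t *\<^sub>R f t)"
    unfolding linear_sum[OF linear_bures_operator]
    using f by (intro sum.cong refl bures_operator_sector x \<open>hbar \<noteq> 0\<close>)
  also have "trace (?P ** \<dots>) = (\<Sum>s\<in>sector_labels. \<Sum>t\<in>sector_labels.
      sector_weight hbar x t * trace (f s ** f t))"
    unfolding trace_sum_mult_sum by (simp add: matrix_scalar_ac scalar_matrix_assoc[symmetric] trace_scaleR)
  also have "\<dots> = (\<Sum>s\<in>sector_labels. \<Sum>t\<in>sector_labels.
      if t = s then sector_weight hbar x s * trace (f s ** f s) else 0)"
    using f by (intro sum.cong refl) (auto simp: trace_sector_orthogonal)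
  finally show ?thesis
    by (simp add: finite_sector_labels)
qed

lemma linear_frame_rep: "linear (frame_rep S)"
  unfolding frame_rep_def by (rule linear_sandwich)

lemma frame_rep_Sym:
  assumes "P \<in> Sym"
  shows "frame_rep S P \<in> Sym"
  using assms by (simp add: Sym_def frame_rep_def matrix_transpose_mul matrix_mul_assoc)

lemma bij_betw_frame_rep:
  assumes "S ** R = mat 1" "R ** S = mat 1"
  shows "bij_betw (frame_rep S) Sym Sym"
proof (rule bij_betw_byWitness[where f' = "frame_rep R"])
  have inv: "frame_rep B (frame_rep A P) = P" if AB: "A ** B = mat 1" for A B P :: "'a mode_matrix"
  proof -
    have "frame_rep B (frame_rep A P) = transpose (A ** B) ** P ** (A ** B)"
      by (simp only: frame_rep_def matrix_transpose_mul matrix_mul_assoc)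
    then show ?thesis
      by (simp add: AB)
  qed
  show "\<forall>P\<in>Sym. frame_rep R (frame_rep S P) = P" "\<forall>P\<in>Sym. frame_rep S (frame_rep R P) = P"
    using assms by (auto simp: inv)
qed (auto simp: frame_rep_Sym)

text \<open>\<open>Omega\<close> equals its own congruence \<open>S ** Omega ** transpose S\<close>,
  so both terms transform alike. The outer factors are the trace adjoint of
  \<open>frame_rep S\<close> and in general not its inverse, so this is a congruence of forms rather
  than a similarity of operators.\<close>

lemma bures_operator_congruence:
  assumes "symplectic S"
  shows "bures_operator hbar (S ** D ** transpose S) P = S ** bures_operator hbar D (frame_rep S P) ** transpose S"
proof -
  have "S ** bures_operator hbar D (frame_rep S P) ** transpose S
      = 8 *\<^sub>R (S ** (D ** frame_rep S P ** D) ** transpose S)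
        + (2 * hbar\<^sup>2) *\<^sub>R (S ** (Omega ** frame_rep S P ** Omega) ** transpose S)"
    unfolding bures_operator_def
    by (simp only: linear_add[OF linear_sandwich] linear_scale[OF linear_sandwich])
  also have "S ** (D ** frame_rep S P ** D) ** transpose S
      = (S ** D ** transpose S) ** P ** (S ** D ** transpose S)"
    by (simp only: frame_rep_def matrix_mul_assoc)
  also have "S ** (Omega ** frame_rep S P ** Omega) ** transpose S
      = (S ** Omega ** transpose S) ** P ** (S ** Omega ** transpose S)"
    by (simp only: frame_rep_def matrix_mul_assoc)
  finally show ?thesis
    using assms by (simp add: bures_operator_def symplectic_def)
qed

lemma bures_cometric_congruence:
  assumes S: "symplectic S" and D: "D \<in> Sym" and P: "P \<in> Sym"
  shows "bures_cometric hbar (S ** D ** transpose S) P = bures_cometric hbar D (frame_rep S P)"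
proof -
  have "S ** D ** transpose S \<in> Sym"
    using D by (simp add: Sym_def matrix_transpose_mul matrix_mul_assoc)
  then have "bures_cometric hbar (S ** D ** transpose S) P
      = trace (P ** (S ** bures_operator hbar D (frame_rep S P) ** transpose S))"
    using trace_represents_bures[of "S ** D ** transpose S" hbar] P
    by (simp add: trace_represents_def bures_operator_congruence[OF S])
  also have "\<dots> = trace ((P ** S ** bures_operator hbar D (frame_rep S P)) ** transpose S)"
    by (simp only: matrix_mul_assoc)
  also have "\<dots> = trace (transpose S ** (P ** S ** bures_operator hbar D (frame_rep S P)))"
    by (rule trace_mul_sym)
  also have "\<dots> = trace (frame_rep S P ** bures_operator hbar D (frame_rep S P))"
    by (simp only: frame_rep_def matrix_mul_assoc)
  also have "\<dots> = bures_cometric hbar D (frame_rep S P)"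
    using trace_represents_bures[OF D] frame_rep_Sym[OF P] by (simp add: trace_represents_def)
  finally show ?thesis .
qed

text \<open>With all factors at least 1, a product bounds each factor from above, so it equals 1
  only if both factors do. The weight therefore vanishes only for sign -1 with both modes at the
  floor, and these are the floor labels.\<close>

lemma sector_weight_zero_iff:
  fixes x :: "'n::{finite,linorder} \<Rightarrow> real"
  assumes "hbar > 0" and x: "\<And>k. x k \<ge> 1" and "s \<in> sector_labels"
  shows "sector_weight hbar x s = 0 \<longleftrightarrow> s \<in> floor_labels {k. x k = 1}"
    and "s \<notin> floor_labels {k. x k = 1} \<Longrightarrow> sector_weight hbar x s > 0"
proof -
  have prod: "x k * x l \<ge> 1" "x k * x l = 1 \<longleftrightarrow> x k = 1 \<and> x l = 1" for k l
  proof -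
    have le: "x k \<le> x k * x l" "x l \<le> x k * x l"
      using mult_left_mono[OF x[of l], of "x k"] mult_left_mono[OF x[of k], of "x l"] x[of k] x[of l]
      by (simp_all add: mult.commute)
    show "x k * x l \<ge> 1"
      using le x[of k] by linarith
    show "x k * x l = 1 \<longleftrightarrow> x k = 1 \<and> x l = 1"
    proof
      assume "x k * x l = 1"
      then show "x k = 1 \<and> x l = 1"
        using le x[of k] x[of l] by (intro conjI) linarith+
    qed simp
  qed
  obtain a b where ab: "(a, b) \<in> sector_support s"
    by (cases s) auto
  have weight: "sector_weight hbar x s = 2 * hbar\<^sup>2 * (x a * x b + sector_sign s)"
    by (rule sector_weight_eq[OF ab])
  have floor: "s \<in> floor_labels {k. x k = 1} \<longleftrightarrow> x a = 1 \<and> x b = 1 \<and> sector_sign s = -1"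
    using assms(3) ab by (cases s) (auto simp: floor_labels_def label_defs)
  have sign: "sector_sign s = 1 \<or> sector_sign s = -1"
    by (cases s) auto
  show "sector_weight hbar x s = 0 \<longleftrightarrow> s \<in> floor_labels {k. x k = 1}"
    using sign prod[of a b] \<open>hbar > 0\<close> unfolding weight floor by auto
  show "s \<notin> floor_labels {k. x k = 1} \<Longrightarrow> sector_weight hbar x s > 0"
    using sign prod[of a b] \<open>hbar > 0\<close> unfolding weight floor by (auto intro!: mult_pos_pos simp: less_le)
qed

section \<open>Assembly: sector spectrum, congruence, kernel and rank\<close>

theorem theorem7:
  fixes hbar :: real
    and \<Sigma> S D :: "'n::{finite,linorder} mode_matrix"
    and \<nu> x :: "'n \<Rightarrow> real"
    and A :: "'n set"
    and N m :: nat
  assumes "hbar > 0"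
    and "N = CARD('n)"
    and "admissible hbar \<Sigma>"
    and "symplectic S"
    and "D = williamson_diag \<nu>"
    and "\<Sigma> = S ** D ** transpose S"
    and "\<And>k. x k = 2 * \<nu> k / hbar"
    and "A = {k. x k = 1}"
    and "m = card A"
  shows
    "(\<forall>k. x k \<ge> 1)
   \<and> trace_represents Sym (bures_operator hbar \<Sigma>) (bures_cometric hbar \<Sigma>)

   \<and> direct_sum_of (Sym :: 'n mode_matrix set) sector_labels sector_space
   \<and> (\<forall>s\<in>sector_labels. \<forall>P\<in>sector_space s.
        bures_operator hbar D P \<in> sector_space s \<and>
        bures_operator hbar D P = sector_weight hbar x s *\<^sub>R P)
   \<and> (\<forall>k::'n. dim (sector_space (Radial k)) = 1)
   \<and> (\<Sum>s\<in>(radial_labels :: 'n sector set). dim (sector_space s)) = N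
   \<and> (\<forall>k::'n. dim (sector_space (Shape k)) = 2)
   \<and> (\<Sum>s\<in>(shape_labels :: 'n sector set). dim (sector_space s)) = 2 * N
   \<and> (\<forall>k l::'n. k < l \<longrightarrow> dim (sector_space (CrossNeg k l)) = 2)
   \<and> (\<Sum>s\<in>(cross_neg_labels :: 'n sector set). dim (sector_space s)) = N * (N - 1)
   \<and> (\<forall>k l::'n. k < l \<longrightarrow> dim (sector_space (CrossPos k l)) = 2)
   \<and> (\<Sum>s\<in>(cross_pos_labels :: 'n sector set). dim (sector_space s)) = N * (N - 1)
   \<and> (\<Sum>s\<in>(sector_labels :: 'n sector set). dim (sector_space s)) = N + 2 * N + 2 * N * (N - 1)
   \<and> N + 2 * N + 2 * N * (N - 1) = N * (2 * N + 1)
   \<and> dim (Sym :: 'n mode_matrix set) = N * (2 * N + 1)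

   \<and> linear (frame_rep S) \<and> bij_betw (frame_rep S) Sym Sym
   \<and> (\<forall>P\<in>Sym. bures_cometric hbar \<Sigma> P = bures_cometric hbar D (frame_rep S P))
   \<and> (\<forall>P\<in>Sym. bures_operator hbar \<Sigma> P = S ** bures_operator hbar D (frame_rep S P) ** transpose S)
   \<and> (\<forall>s\<in>sector_labels. \<forall>P\<in>Sym. frame_rep S P \<in> sector_space s \<longrightarrow>
        bures_operator hbar \<Sigma> P = sector_weight hbar x s *\<^sub>R (S ** frame_rep S P ** transpose S) \<and>
        bures_cometric hbar \<Sigma> P = sector_weight hbar x s * trace (frame_rep S P ** frame_rep S P))
   \<and> (\<forall>P\<in>Sym. \<forall>f. (\<forall>s\<in>sector_labels. f s \<in> sector_space s) \<and>
          frame_rep S P = (\<Sum>s\<in>sector_labels. f s) \<longrightarrow>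
        bures_cometric hbar \<Sigma> P = (\<Sum>s\<in>sector_labels. sector_weight hbar x s * trace (f s ** f s)))
   \<and> inertia Sym (bures_cometric hbar \<Sigma>) = inertia Sym (bures_cometric hbar D)
   \<and> (\<exists>(\<Sigma>' :: 'n mode_matrix) S' \<nu>'. admissible hbar \<Sigma>' \<and> symplectic S' \<and>
        \<Sigma>' = S' ** williamson_diag \<nu>' ** transpose S' \<and>
        eigenvalues_on Sym (bures_operator hbar \<Sigma>')
          \<noteq> eigenvalues_on Sym (bures_operator hbar (williamson_diag \<nu>')))

   \<and> dim (form_kernel Sym (bures_cometric hbar \<Sigma>)) = m\<^sup>2
   \<and> frame_rep S ` form_kernel Sym (bures_cometric hbar \<Sigma>)
       = span (\<Union>s\<in>floor_labels A. sector_space s)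
   \<and> (\<forall>s \<in> sector_labels - floor_labels A. sector_weight hbar x s > 0)
   \<and> (\<forall>P\<in>Sym. P \<noteq> 0 \<and> frame_rep S P \<in> span (\<Union>s \<in> sector_labels - floor_labels A. sector_space s)
        \<longrightarrow> bures_cometric hbar \<Sigma> P > 0)
   \<and> (\<forall>k. sector_weight hbar x (Shape k) \<ge> 4 * hbar\<^sup>2)
   \<and> (\<forall>k l. k < l \<longrightarrow> sector_weight hbar x (CrossPos k l) \<ge> 4 * hbar\<^sup>2)
   \<and> ((\<forall>k. x k > 1) \<longrightarrow> form_kernel Sym (bures_cometric hbar \<Sigma>) = {0})
   \<and> (dim (bures_operator hbar \<Sigma> ` Sym) < dim (Sym :: 'n mode_matrix set)
        \<longleftrightarrow> (\<exists>k. \<nu> k = hbar / 2))"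
proof -
  have hbar: "hbar \<noteq> 0"
    using \<open>hbar > 0\<close> by simp
  have D: "D \<in> Sym"
    using \<open>D = williamson_diag \<nu>\<close> by (simp add: Sym_def transpose_williamson_diag)
  have \<Sigma>: "\<Sigma> \<in> Sym"
    using \<open>admissible hbar \<Sigma>\<close> by (simp add: admissible_def)
  have \<nu>: "hbar / 2 \<le> \<nu> k" for k
    using admissible_symplectic_eigenvalue_ge assms(3-6) by blast
  have x: "x k \<ge> 1" for k
    using \<nu>[of k] \<open>hbar > 0\<close> by (simp add: assms(7) field_simps)
  obtain R where R: "S ** R = mat 1" "R ** S = mat 1"
    using symplectic_inverse[OF \<open>symplectic S\<close>] .
  have bij: "bij_betw (frame_rep S) Sym Sym"
    by (rule bij_betw_frame_rep[OF R])
  have rep: "trace_represents Sym (bures_operator hbar \<Sigma>) (bures_cometric hbar \<Sigma>)"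
    by (rule trace_represents_bures[OF \<Sigma>])
  have eig: "bures_operator hbar D P = sector_weight hbar x s *\<^sub>R P" if "P \<in> sector_space s" for s P
    using bures_operator_sector[OF that assms(7) hbar] assms(5) by simp
  have oper: "bures_operator hbar \<Sigma> P = S ** bures_operator hbar D (frame_rep S P) ** transpose S" for P
    using bures_operator_congruence[OF \<open>symplectic S\<close>] assms(6) by simp
  have comet: "bures_cometric hbar \<Sigma> P = bures_cometric hbar D (frame_rep S P)" if "P \<in> Sym" for P
    using bures_cometric_congruence[OF \<open>symplectic S\<close> D that] assms(6) by simp
  have decomp: "bures_cometric hbar \<Sigma> P = (\<Sum>s\<in>sector_labels. sector_weight hbar x s * trace (f s ** f s))"
    if "P \<in> Sym" "\<forall>s\<in>sector_labels. f s \<in> sector_space s" "frame_rep S P = (\<Sum>s\<in>sector_labels. f s)" for P f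
    using bures_cometric_sector_sum[OF assms(7) hbar, of f] that comet[OF that(1)] assms(5) by simp
  have floor_sub: "floor_labels A \<subseteq> sector_labels"
    by (auto simp: floor_labels_def label_defs)
  have kerD: "form_kernel Sym (bures_cometric hbar D) = span (\<Union>s\<in>floor_labels A. sector_space s)"
  proof -
    have "{s \<in> sector_labels. sector_weight hbar x s = 0} = floor_labels A"
      using sector_weight_zero_iff(1)[of hbar x, OF \<open>hbar > 0\<close> x] floor_sub assms(8) by blast
    then show ?thesis
      using kernel_diagonal_on_direct_sum[OF direct_sum_sectors linear_bures_operator eig]
      by (simp add: form_kernel_trace_represents[OF trace_represents_bures[OF D]])
  qed
  have ker: "frame_rep S ` form_kernel Sym (bures_cometric hbar \<Sigma>) = form_kernel Sym (bures_cometric hbar D)"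
    by (rule form_kernel_congruence[where q = "bures_cometric hbar \<Sigma>" and q' = "bures_cometric hbar D",
        OF linear_frame_rep bij subspace_Sym comet])
  have dim_ker: "dim (form_kernel Sym (bures_cometric hbar \<Sigma>)) = m\<^sup>2"
  proof -
    have "span (form_kernel Sym (bures_cometric hbar \<Sigma>)) \<subseteq> Sym"
      by (rule span_minimal[OF _ subspace_Sym]) (auto simp: form_kernel_def)
    then have "dim (form_kernel Sym (bures_cometric hbar \<Sigma>))
        = dim (frame_rep S ` form_kernel Sym (bures_cometric hbar \<Sigma>))"
      using bij by (intro dim_image_eq[OF linear_frame_rep, symmetric]) (auto simp: bij_betw_def intro: inj_on_subset)
    also have "\<dots> = m\<^sup>2"
      unfolding ker kerD dim_span_direct_sum[OF direct_sum_sectors floor_sub] sum_dim_floor_labels assms(9) ..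
    finally show ?thesis .
  qed
  have ker_zero: "0 \<in> form_kernel Sym (bures_cometric hbar \<Sigma>)"
    unfolding form_kernel_trace_represents[OF rep]
    by (simp add: linear_0[OF linear_bures_operator] subspace_0[OF subspace_Sym])
  \<comment> \<open>Triviality is read off the dimension: \<open>m\<^sup>2\<close> is zero exactly
    when no mode sits at the floor.\<close>
  have ker_trivial: "form_kernel Sym (bures_cometric hbar \<Sigma>) = {0} \<longleftrightarrow> (\<forall>k. x k \<noteq> 1)"
  proof -
    have "form_kernel Sym (bures_cometric hbar \<Sigma>) = {0} \<longleftrightarrow> m\<^sup>2 = 0"
      unfolding dim_ker[symmetric] dim_eq_0 using ker_zero by blast
    then show ?thesis
      using assms(8,9) by auto
  qed
  have pos: "bures_cometric hbar \<Sigma> P > 0"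
    if P: "P \<in> Sym" "P \<noteq> 0" and span: "frame_rep S P \<in> span (\<Union>s \<in> sector_labels - floor_labels A. sector_space s)" for P
  proof -
    obtain f where f: "\<forall>s\<in>sector_labels - floor_labels A. f s \<in> sector_space s"
      "frame_rep S P = (\<Sum>s\<in>sector_labels - floor_labels A. f s)"
      using span finite_sector_labels subspace_sector_space
      by (subst (asm) span_UN_subspaces) auto
    \<comment> \<open>Padding with zero on the floor labels gives a family over all sectors, to
      which the expansion \<open>decomp\<close> applies.\<close>
    define g where "g s = (if s \<in> floor_labels A then 0 else f s)" for s
    have g: "\<forall>s\<in>sector_labels. g s \<in> sector_space s"
      using f by (auto simp: g_def subspace_0[OF subspace_sector_space])
    have sum_g: "frame_rep S P = (\<Sum>s\<in>sector_labels. g s)"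
      unfolding f(2) by (rule sum.mono_neutral_cong_left) (auto simp: g_def finite_sector_labels)
    have "frame_rep S P \<noteq> 0"
      using inj_onD[OF bij_betw_imp_inj_on[OF bij], of P 0] P linear_0[OF linear_frame_rep, of S]
        subspace_0[OF subspace_Sym] by auto
    then obtain s where s: "s \<in> sector_labels" "g s \<noteq> 0"
      unfolding sum_g by (meson sum.neutral)
    have sq: "trace (g t ** g t) = g t \<bullet> g t" if "t \<in> sector_labels" for t
      using g that by (intro trace_mult_self_Sym) (auto simp: sector_space_eq)
    have weight: "sector_weight hbar x t > 0" if "t \<in> sector_labels" "g t \<noteq> 0" for t
      using sector_weight_zero_iff(2)[of hbar x, OF \<open>hbar > 0\<close> x that(1)] that(2) assms(8)
      by (auto simp: g_def split: if_splits)
    \<comment> \<open>Every nonzero component lies in a sector of positive weight, and at least one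
      is nonzero because \<open>frame_rep S\<close> is injective on \<open>Sym\<close>.\<close>
    have "0 < (\<Sum>t\<in>sector_labels. sector_weight hbar x t * trace (g t ** g t))"
    proof (rule sum_pos2[OF finite_sector_labels s(1)])
      show "0 < sector_weight hbar x s * trace (g s ** g s)"
        using weight[OF s] s by (simp add: sq)
      show "0 \<le> sector_weight hbar x t * trace (g t ** g t)" if "t \<in> sector_labels" for t
        unfolding sq[OF that] using weight[OF that] by (cases "g t = 0") simp_all
    qed
    then show ?thesis
      using decomp[OF P(1) g sum_g] by simp
  qed
  have prod: "x k * x l \<ge> 1" for k l
    using mult_mono[of 1 "x k" 1 "x l"] x[of k] x[of l] by simp
  have weight_ge: "4 * hbar\<^sup>2 \<le> 2 * hbar\<^sup>2 * (x k * x l + 1)" for k l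
    using mult_left_mono[of 2 "x k * x l + 1" "2 * hbar\<^sup>2"] prod[of k l] by simp
  have floor_iff: "x k = 1 \<longleftrightarrow> \<nu> k = hbar / 2" for k
    using hbar by (auto simp: assms(7) field_simps)
  show ?thesis
  proof (intro conjI allI ballI impI)
    fix k :: 'n
    show "1 \<le> x k" by (rule x)
  next
    show "trace_represents Sym (bures_operator hbar \<Sigma>) (bures_cometric hbar \<Sigma>)" by (rule rep)
  next
    show "direct_sum_of (Sym :: 'n mode_matrix set) sector_labels sector_space" by (rule direct_sum_sectors)
  next
    fix s :: "'n sector" and P assume "P \<in> sector_space s"
    then show "bures_operator hbar D P \<in> sector_space s"
      by (simp add: eig subspace_scale[OF subspace_sector_space])
  next
    fix s :: "'n sector" and P assume "P \<in> sector_space s"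
    then show "bures_operator hbar D P = sector_weight hbar x s *\<^sub>R P" by (rule eig)
  next
    fix P s assume "frame_rep S P \<in> sector_space s"
    then show "bures_operator hbar \<Sigma> P = sector_weight hbar x s *\<^sub>R (S ** frame_rep S P ** transpose S)"
      unfolding oper by (simp only: eig linear_scale[OF linear_sandwich])
  next
    fix P s assume P: "P \<in> Sym" "frame_rep S P \<in> sector_space s"
    have "bures_cometric hbar \<Sigma> P = trace (frame_rep S P ** bures_operator hbar D (frame_rep S P))"
      using trace_represents_bures[OF D] frame_rep_Sym[OF P(1)] comet[OF P(1)] by (simp add: trace_represents_def)
    then show "bures_cometric hbar \<Sigma> P = sector_weight hbar x s * trace (frame_rep S P ** frame_rep S P)"
      by (simp only: eig[OF P(2)] matrix_scalar_ac scalar_matrix_assoc[symmetric] trace_scaleR)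
  next
    show "inertia Sym (bures_cometric hbar \<Sigma>) = inertia Sym (bures_cometric hbar D)"
      by (rule inertia_congruence[where q = "bures_cometric hbar \<Sigma>" and q' = "bures_cometric hbar D",
          OF linear_frame_rep bij subspace_Sym comet])
  next
    fix s assume "s \<in> sector_labels - floor_labels A"
    then show "sector_weight hbar x s > 0"
      using sector_weight_zero_iff(2)[of hbar x, OF \<open>hbar > 0\<close> x] assms(8) by blast
  next
    assume "\<forall>k. x k > 1"
    then show "form_kernel Sym (bures_cometric hbar \<Sigma>) = {0}"
      unfolding ker_trivial by (metis less_irrefl)
  next
    \<comment> \<open>Loss of rank amounts to a nontrivial radical by self-adjointness, and that to
      some \<open>x k = 1\<close>.\<close>
    show "dim (bures_operator hbar \<Sigma> ` Sym) < dim (Sym :: 'n mode_matrix set) \<longleftrightarrow> (\<exists>k. \<nu> k = hbar / 2)"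
      unfolding dim_image_self_adjoint_less_iff[OF rep] ker_trivial floor_iff by blast
  next
    show "\<exists>(\<Sigma>' :: 'n mode_matrix) S' \<nu>'. admissible hbar \<Sigma>' \<and> symplectic S' \<and>
        \<Sigma>' = S' ** williamson_diag \<nu>' ** transpose S' \<and>
        eigenvalues_on Sym (bures_operator hbar \<Sigma>')
          \<noteq> eigenvalues_on Sym (bures_operator hbar (williamson_diag \<nu>'))"
      by (rule eigenvalues_not_congruence_invariant[OF \<open>hbar > 0\<close>])
  next
    fix P f
    assume "P \<in> Sym" "(\<forall>s\<in>sector_labels. f s \<in> sector_space s) \<and> frame_rep S P = (\<Sum>s\<in>sector_labels. f s)"
    then show "bures_cometric hbar \<Sigma> P = (\<Sum>s\<in>sector_labels. sector_weight hbar x s * trace (f s ** f s))"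
      using decomp by blast
  next
    fix P
    assume "P \<in> Sym" "P \<noteq> 0 \<and> frame_rep S P \<in> span (\<Union>s \<in> sector_labels - floor_labels A. sector_space s)"
    then show "bures_cometric hbar \<Sigma> P > 0"
      using pos by blast
  next
    fix k l :: 'n assume "k < l"
    then show "dim (sector_space (CrossNeg k l)) = 2" and "dim (sector_space (CrossPos k l)) = 2"
      using dim_Cross[of k l] by simp_all
    show "sector_weight hbar x (CrossPos k l) \<ge> 4 * hbar\<^sup>2"
      using weight_ge by simp
  next
    fix k
    show "sector_weight hbar x (Shape k) \<ge> 4 * hbar\<^sup>2"
      using weight_ge[of k k] by (simp add: power2_eq_square)
  qed (simp_all only: assms(2) dim_Radial dim_Shape sum_dim_radial_labels sum_dim_shape_labels
      sum_dim_cross_neg_labels sum_dim_cross_pos_labels sum_dim_sector_labels sum_multiplicities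
      dim_Sym_mode_matrix linear_frame_rep bij comet oper dim_ker ker kerD)
qed

end
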